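(* Let $d\ge1$, let $a(0)=1,a(1),a(2),\dots$ and $a^*(0)=1,a^*(1),\dots$ be sequences, and let $s,t$ be indeterminates. For $\pi\in\mathrm{NC}^d_{dk+1}$ define $$\mathrm{wt}(\pi)=\prod_{B\in\pi}a\!\left(\tfrac{|B|-1}{d}\right)\prod_{C'\in\pi'}a^*\!\left(\tfrac{|C'|-1}{d}\right)s^{(|\pi|-1)/d}\,t^{(|\pi'|-1)/d}.$$ Let $A(x)=\sum_{k\ge0}a(k)x^k$, $A^*(x)=\sum_{k\ge0}a^*(k)x^k$, $B(x)=\sum_{k\ge0}b(k)x^k$ with $b(k)=\sum_{\pi\in\mathrm{NC}^d_{dk+1}}\mathrm{wt}(\pi)$, $C(x)=\sum_{k\ge0}c(k)x^k$ with $c(k)=\sum_{\pi\in\mathrm{NC}^d_{dk+1},\,\{1\}\in\pi}\mathrm{wt}(\pi)$, and $C^*(x)=\sum_{k\ge0}c^*(k)x^k$ with $c^*(k)=\sum_{\pi\in\mathrm{NC}^d_{dk+1},\,\{1'\}\in\pi'}\mathrm{wt}(\pi)$. Then $$C(x)=A^*\!\left(x\cdot s\cdot C^*(x)^d\right),\qquad C^*(x)=A\!\left(x\cdot t\cdot C(x)^d\right),\qquad B(x)=C(x)\cdot C^*(x).$$ Furthermore, the first two equations uniquely determine the formal power series $C(x)$ and $C^*(x)$.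
   Context: A partition of $[n]$ is noncrossing if there are no $i<j<k<\ell$ with $i,k$ in one block and $j,\ell$ in a different block. The Kreweras dual $\pi'$ of a noncrossing partition $\pi$ of $[n]$: place $1,1',2,2',\dots,n,n'$ on a circle in this cyclic order; $\pi'$ is the coarsest partition of $\{1',\dots,n'\}$ such that the blocks of $\pi$ and of $\pi'$ together form a noncrossing partition of these $2n$ points. $\mathrm{NC}^d_n$ is the set of noncrossing partitions $\pi$ of $[n]$ such that every block of $\pi$ and every block of $\pi'$ has cardinality congruent to $1$ modulo $d$. $|\pi|$ denotes the number of blocks of $\pi$. *)

theory Defs
  imports
    "HOL-Library.Disjoint_Sets"
    "HOL-Number_Theory.Cong"
    "HOL-Computational_Algebra.Formal_Power_Series"
begin

definition noncrossing :: "nat set set \<Rightarrow> bool" where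
  "noncrossing P \<longleftrightarrow>
     \<not> (\<exists>B\<in>P. \<exists>C\<in>P. B \<noteq> C \<and>
          (\<exists>i\<in>B. \<exists>j\<in>C. \<exists>k\<in>B. \<exists>l\<in>C. i < j \<and> j < k \<and> k < l))"

(* The 2n points 1, 1', 2, 2', ..., n, n' on the circle are numbered 1, ..., 2n in
   this order, so i becomes 2i - 1 and i' becomes 2i.  Cutting the circle between
   n' and 1 is harmless: crossing is invariant under rotation.  A partition of
   {1', ..., n'} is represented by the partition of {1..n} with the primes dropped. *)
definition interleave :: "nat set set \<Rightarrow> nat set set \<Rightarrow> nat set set" where
  "interleave P Q = (\<lambda>B. (\<lambda>i. 2 * i - 1) ` B) ` P \<union> (\<lambda>C. (\<lambda>i. 2 * i) ` C) ` Q"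

(* Coarsest = greatest with respect to refinement, hence unique (refines_asym). *)
definition kreweras :: "nat \<Rightarrow> nat set set \<Rightarrow> nat set set" where
  "kreweras n P =
     (THE Q. partition_on {1..n} Q \<and> noncrossing (interleave P Q) \<and>
        (\<forall>R. partition_on {1..n} R \<and> noncrossing (interleave P R) \<longrightarrow> refines {1..n} R Q))"

definition NC :: "nat \<Rightarrow> nat \<Rightarrow> nat set set set" where
  "NC d n = {P. partition_on {1..n} P \<and> noncrossing P \<and>
     (\<forall>B\<in>P. [card B = 1] (mod d)) \<and> (\<forall>C\<in>kreweras n P. [card C = 1] (mod d))}"

(* The parameters s and t are elements of the coefficient ring; the case of indeterminates
   is the one where this ring is a polynomial ring in s and t.
   For P in NC d (d * k + 1) with d > 0 all the divisions below are exact: the block sizes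
   are congruent to 1 modulo d and add up to d * k + 1, so the number of blocks is
   congruent to 1 modulo d as well, for P and for its dual. *)
definition wt :: "nat \<Rightarrow> (nat \<Rightarrow> 'a::comm_ring_1) \<Rightarrow> (nat \<Rightarrow> 'a) \<Rightarrow> 'a \<Rightarrow> 'a \<Rightarrow> nat \<Rightarrow> nat set set \<Rightarrow> 'a"
  where
  "wt d a a' s t n P =
     (\<Prod>B\<in>P. a ((card B - 1) div d)) * (\<Prod>C\<in>kreweras n P. a' ((card C - 1) div d)) *
     s ^ ((card P - 1) div d) * t ^ ((card (kreweras n P) - 1) div d)"

definition B_fps :: "nat \<Rightarrow> (nat \<Rightarrow> 'a::comm_ring_1) \<Rightarrow> (nat \<Rightarrow> 'a) \<Rightarrow> 'a \<Rightarrow> 'a \<Rightarrow> 'a fps" where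
  "B_fps d a a' s t =
     Abs_fps (\<lambda>k. \<Sum>P\<in>NC d (d * k + 1). wt d a a' s t (d * k + 1) P)"

definition C_fps :: "nat \<Rightarrow> (nat \<Rightarrow> 'a::comm_ring_1) \<Rightarrow> (nat \<Rightarrow> 'a) \<Rightarrow> 'a \<Rightarrow> 'a \<Rightarrow> 'a fps" where
  "C_fps d a a' s t =
     Abs_fps (\<lambda>k. \<Sum>P\<in>{P \<in> NC d (d * k + 1). {1} \<in> P}. wt d a a' s t (d * k + 1) P)"

definition Cstar_fps :: "nat \<Rightarrow> (nat \<Rightarrow> 'a::comm_ring_1) \<Rightarrow> (nat \<Rightarrow> 'a) \<Rightarrow> 'a \<Rightarrow> 'a \<Rightarrow> 'a fps" where
  "Cstar_fps d a a' s t =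
     Abs_fps (\<lambda>k. \<Sum>P\<in>{P \<in> NC d (d * k + 1). {1} \<in> kreweras (d * k + 1) P}.
       wt d a a' s t (d * k + 1) P)"

end

theory Submission
  imports Defs
begin

text \<open>
  A noncrossing partition \<open>\<pi>\<close> of \<open>[n]\<close> and its dual together form a partition of the \<open>2n\<close> points
  \<open>1, 1', \<dots>, n, n'\<close>, which is the same as a plane tree with \<open>n\<close> edges: the vertices are the blocks, two
  colours alternate, and the angles at the vertices are the points.  Such a partition is characterised
  by a condition symmetric in the two colours: two points \<open>x < y\<close> of the same colour are in one block
  iff the points of the other colour between them form a union of blocks.  The condition makes sense
  on every interval of integers coloured by parity.  On an interval of even length the block of the
  first point ends just before the block of the last point begins; cutting there gives two
  intervals of odd length, whence \<open>B = C C\<^sup>*\<close>.  On an interval of odd length the first and the last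
  point are in the same block; deleting the last point leads back to even length, so the block is
  peeled off one point at a time, and the generating function with a weight \<open>h\<close> on the size of the
  first block becomes \<open>h\<close> composed with \<open>x\<close> times the generating function of the other colour.

  The powers of \<open>s\<close> and \<open>t\<close> are absorbed into the weights of the blocks, since
  \<open>|\<pi>| + |\<pi>'| = n + 1\<close>, and the congruence conditions by letting the other block weights vanish.  This
  reduces the theorem to \<open>d = 1\<close>, up to passing to the coefficients of \<open>x\<^sup>d\<^sup>k\<close>.
\<close>

section \<open>Self-dual alternating partitions of an interval\<close>

text \<open>Partitions are handled through this relation, which is an equivalence on the ground set
  and false outside it; \<open>partition_eqI\<close> leads back to equality of partitions.\<close>

definition linked :: "nat set set \<Rightarrow> nat \<Rightarrow> nat \<Rightarrow> bool" where
  "linked P x y \<longleftrightarrow> (\<exists>B\<in>P. x \<in> B \<and> y \<in> B)"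

definition block_of :: "nat set set \<Rightarrow> nat \<Rightarrow> nat set" where
  "block_of P x = {y. linked P x y}"

lemma linked_sym: "linked P x y \<Longrightarrow> linked P y x"
  by (auto simp: linked_def)

lemma linked_trans: "partition_on A P \<Longrightarrow> linked P x y \<Longrightarrow> linked P y z \<Longrightarrow> linked P x z"
  unfolding linked_def partition_on_def disjoint_def by blast

lemma linked_in: "partition_on A P \<Longrightarrow> linked P x y \<Longrightarrow> x \<in> A \<and> y \<in> A"
  by (auto simp: linked_def partition_on_def)

lemma linked_refl: "partition_on A P \<Longrightarrow> x \<in> A \<Longrightarrow> linked P x x"
  by (auto simp: linked_def partition_on_def)

lemma linked_Un: "linked (P \<union> Q) x y \<longleftrightarrow> linked P x y \<or> linked Q x y"
  by (auto simp: linked_def)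

lemma linked_subset: "P \<subseteq> Q \<Longrightarrow> linked P x y \<Longrightarrow> linked Q x y"
  by (auto simp: linked_def)

lemma partition_eq_block: "partition_on A P \<Longrightarrow> B \<in> P \<Longrightarrow> x \<in> B \<Longrightarrow> B = block_of P x"
  unfolding block_of_def linked_def partition_on_def disjoint_def by blast

lemma block_of_in: "partition_on A P \<Longrightarrow> x \<in> A \<Longrightarrow> block_of P x \<in> P"
  using partition_eq_block[of A P _ x] by (force simp: partition_on_def)

lemma in_block_of_self: "partition_on A P \<Longrightarrow> x \<in> A \<Longrightarrow> x \<in> block_of P x"
  by (simp add: block_of_def linked_refl)

lemma in_block_of_iff: "y \<in> block_of P x \<longleftrightarrow> linked P x y"
  by (simp add: block_of_def)

lemma partition_eqI:
  assumes "partition_on A P" "partition_on A Q" "\<And>x y. linked P x y \<longleftrightarrow> linked Q x y"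
  shows "P = Q"
proof -
  have "{(x, y). \<exists>p \<in> P. x \<in> p \<and> y \<in> p} = {(x, y). \<exists>p \<in> Q. x \<in> p \<and> y \<in> p}"
    using assms(3) by (auto simp: linked_def)
  then show ?thesis
    using partition_on_eq_quotient[OF assms(1)] partition_on_eq_quotient[OF assms(2)] by metis
qed

text \<open>Only blocks of the colour opposite to \<open>x\<close> are constrained. The condition is
  vacuous for \<open>y \<le> x\<close>, so \<open>biNC_sealed\<close> holds for linked points in
  either order.\<close>

definition sealed :: "nat set set \<Rightarrow> nat \<Rightarrow> nat \<Rightarrow> bool" where
  "sealed P x y \<longleftrightarrow> (\<forall>u v. linked P u v \<longrightarrow> odd (x + u) \<longrightarrow> x < u \<longrightarrow> u < y \<longrightarrow> x < v \<and> v < y)"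

text \<open>Parity is the colour.  The elements of \<open>biNC 1 (2 * n + 1)\<close> are the noncrossing partitions of
  \<open>{1..n}\<close> interleaved with their Kreweras duals.\<close>
definition biNC :: "nat \<Rightarrow> nat \<Rightarrow> nat set set set" where
  "biNC a b = {P. partition_on {a..<b} P \<and>
     (\<forall>x y. linked P x y \<longrightarrow> even (x + y)) \<and>
     (\<forall>x y. a \<le> x \<longrightarrow> x < y \<longrightarrow> y < b \<longrightarrow> even (x + y) \<longrightarrow> (linked P x y \<longleftrightarrow> sealed P x y))}"

lemma biNC_partition: "P \<in> biNC a b \<Longrightarrow> partition_on {a..<b} P"
  unfolding biNC_def mem_Collect_eq by (elim conjE)

lemma biNC_even:
  assumes "P \<in> biNC a b" and "linked P x y"
  shows "even (x + y)"
proof -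
  have "\<forall>x y. linked P x y \<longrightarrow> even (x + y)"
    using assms(1) unfolding biNC_def mem_Collect_eq by (elim conjE)
  then show ?thesis using assms(2) by blast
qed

lemma biNC_linked_iff:
  assumes "P \<in> biNC a b" and "a \<le> x" "x < y" "y < b" "even (x + y)"
  shows "linked P x y \<longleftrightarrow> sealed P x y"
proof -
  have "\<forall>x y. a \<le> x \<longrightarrow> x < y \<longrightarrow> y < b \<longrightarrow> even (x + y) \<longrightarrow> (linked P x y \<longleftrightarrow> sealed P x y)"
    using assms(1) unfolding biNC_def mem_Collect_eq by (elim conjE)
  then show ?thesis using assms(2-) by blast
qed

lemma biNC_sealed: "P \<in> biNC a b \<Longrightarrow> linked P x y \<Longrightarrow> sealed P x y"
proof -
  assume P: "P \<in> biNC a b" "linked P x y"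
  show ?thesis
  proof (cases "x < y")
    case True
    moreover have "a \<le> x" "y < b" "even (x + y)"
      using linked_in[OF biNC_partition[OF P(1)] P(2)] biNC_even[OF P] by auto
    ultimately show ?thesis
      using P biNC_linked_iff[of P a b x y] by blast
  qed (auto simp: sealed_def)
qed

lemma biNC_nc: "P \<in> biNC a b \<Longrightarrow> linked P x y \<Longrightarrow> linked P u v \<Longrightarrow> odd (x + u) \<Longrightarrow> x < u \<Longrightarrow> u < y
   \<Longrightarrow> x < v \<and> v < y"
  using biNC_sealed[of P a b x y] unfolding sealed_def by blast

lemma biNC_linkedI: "P \<in> biNC a b \<Longrightarrow> a \<le> x \<Longrightarrow> x < y \<Longrightarrow> y < b \<Longrightarrow> even (x + y) \<Longrightarrow> sealed P x y \<Longrightarrow> linked P x y"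
  using biNC_linked_iff by blast

lemma biNC_bounds: "P \<in> biNC a b \<Longrightarrow> linked P x y \<Longrightarrow> a \<le> x \<and> x < b \<and> a \<le> y \<and> y < b"
  using linked_in[OF biNC_partition] by force

lemma biNCI:
  assumes "partition_on {a..<b} P"
    and "\<And>x y. linked P x y \<Longrightarrow> even (x + y)"
    and "\<And>x y u v. linked P x y \<Longrightarrow> linked P u v \<Longrightarrow> odd (x + u) \<Longrightarrow> x < u \<Longrightarrow> u < y \<Longrightarrow> x < v \<and> v < y"
    and "\<And>x y. a \<le> x \<Longrightarrow> x < y \<Longrightarrow> y < b \<Longrightarrow> even (x + y) \<Longrightarrow> sealed P x y \<Longrightarrow> linked P x y"
  shows "P \<in> biNC a b"
proof -
  have "sealed P x y" if "linked P x y" for x y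
    unfolding sealed_def using assms(3)[OF that] by blast
  then show ?thesis
    unfolding biNC_def using assms(1,2,4) by blast
qed

text \<open>For opposite colours the crossing contradicts that \<open>i\<close> and \<open>k\<close>
  are sealed. For equal colours, a block of the other colour that meets the interval between
  \<open>j\<close> and \<open>k\<close> stays between \<open>i\<close> and \<open>k\<close> and
  between \<open>j\<close> and \<open>l\<close>, hence between \<open>j\<close> and
  \<open>k\<close>; so \<open>j\<close> and \<open>k\<close> are sealed and therefore
  linked.\<close>

lemma biNC_noncrossing:
  assumes P: "P \<in> biNC a b" and l: "linked P i k" "linked P j l" and "i < j" "j < k" "k < l"
  shows "linked P i j"
proof (cases "even (i + j)")
  case True
  have "even (i + k)" using biNC_even[OF P l(1)] .
  have "sealed P j k" unfolding sealed_def
  proof (intro allI impI)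
    fix u v assume u: "linked P u v" "odd (j + u)" "j < u" "u < k"
    from biNC_nc[OF P l(1) u(1)] True u assms have 1: "i < v \<and> v < k" by auto
    from biNC_nc[OF P l(2) u(1)] True u assms have 2: "j < v \<and> v < l" by auto
    from 1 2 show "j < v \<and> v < k" by auto
  qed
  moreover have "a \<le> j" "k < b" using biNC_bounds[OF P] l by blast+
  ultimately have "linked P j k"
    using biNC_linkedI[OF P, of j k] \<open>j < k\<close> \<open>even (i + k)\<close> True by auto
  then show ?thesis
    using linked_trans[OF biNC_partition[OF P]] l linked_sym by blast
next
  case False
  then show ?thesis using biNC_nc[OF P l(1,2)] assms by auto
qed

text \<open>Both end points have the same colour, so every point of the other colour lies strictly
  between them and the pair is sealed.\<close>

lemma biNC_first_last:
  assumes P: "P \<in> biNC a b" and "a < b" "odd (b - a)"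
  shows "linked P a (b - 1)"
proof (cases "a = b - 1")
  case True
  then show ?thesis using linked_refl[OF biNC_partition[OF P], of a] assms by auto
next
  case False
  have ev: "even (a + (b - 1))" using assms(2,3) by presburger
  have "sealed P a (b - 1)" unfolding sealed_def
  proof (intro allI impI)
    fix u v assume u: "linked P u v" "odd (a + u)" "a < u" "u < b - 1"
    have "even (u + v)" "a \<le> v" "v < b" using biNC_even[OF P u(1)] biNC_bounds[OF P u(1)] by auto
    then have "v \<noteq> a" "v \<noteq> b - 1" using u(2) ev by presburger+
    then show "a < v \<and> v < b - 1" using \<open>a \<le> v\<close> \<open>v < b\<close> by auto
  qed
  then show ?thesis using biNC_linkedI[OF P, of a "b - 1"] ev False assms by auto
qed

text \<open>The blocks in \<open>Q\<close> are whole blocks of \<open>P\<close>, so a point of the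
  subinterval has the same block in both, and sealing inside the subinterval means the same for
  both.\<close>

lemma biNC_restrict:
  assumes P: "P \<in> biNC a b" and "Q \<subseteq> P" and Q: "partition_on {c..<e} Q"
  shows "Q \<in> biNC c e"
proof (rule biNCI)
  have sub: "linked P x y" if "linked Q x y" for x y using linked_subset[OF assms(2) that] .
  have conv: "linked Q x y" if "linked P x y" "c \<le> x" "x < e" for x y
  proof -
    have x: "linked Q x x" using linked_refl[OF Q] that by auto
    then have "block_of P x = block_of Q x"
      using partition_eq_block[OF biNC_partition[OF P], of "block_of Q x" x] block_of_in[OF Q, of x] that assms(2)
      by (auto simp: block_of_def)
    then show ?thesis using that by (auto simp: block_of_def)
  qed
  show "partition_on {c..<e} Q" by fact
  show "even (x + y)" if "linked Q x y" for x y using biNC_even[OF P sub[OF that]] .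
  show "x < v \<and> v < y" if "linked Q x y" "linked Q u v" "odd (x + u)" "x < u" "u < y" for x y u v
    using biNC_nc[OF P sub sub] that by blast
  show "linked Q x y" if "c \<le> x" "x < y" "y < e" "even (x + y)" "sealed Q x y" for x y
  proof -
    have "linked P x x" "linked P y y" using sub linked_refl[OF Q] that by auto
    then have "a \<le> x" "y < b" using biNC_bounds[OF P] by blast+
    moreover have "sealed P x y"
      unfolding sealed_def
    proof (intro allI impI)
      fix u v assume u: "linked P u v" "odd (x + u)" "x < u" "u < y"
      then have "linked Q u v" using conv[of u v] that by auto
      with u that(5) show "x < v \<and> v < y" unfolding sealed_def by blast
    qed
    ultimately show ?thesis using biNC_linkedI[OF P] conv that by auto
  qed
qed

lemma finite_biNC: "finite (biNC a b)"
  by (rule finite_subset[OF _ finitely_many_partition_on[of "{a..<b}"]]) (auto simp: biNC_def)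

lemma biNC_singleton: "biNC a (Suc a) = {{{a}}}"
proof -
  have "P = {{a}}" if "partition_on {a} P" for P :: "nat set set"
  proof -
    have "B = {a}" if "B \<in> P" for B
      using that \<open>partition_on {a} P\<close> unfolding partition_on_def by (metis Sup_upper subset_singletonD)
    moreover have "P \<noteq> {}" using that by (auto simp: partition_on_def)
    ultimately show ?thesis by blast
  qed
  moreover have "{{a}} \<in> biNC a (Suc a)"
    by (rule biNCI) (auto simp: linked_def partition_on_def)
  moreover have "{a..<Suc a} = {a}" by auto
  ultimately show ?thesis using biNC_partition by fastforce
qed

section \<open>Splitting an interval of even length\<close>

lemma partition_on_Un:
  assumes "partition_on A P" "partition_on B Q" "A \<inter> B = {}"
  shows "partition_on (A \<union> B) (P \<union> Q)"
  using assms disjoint_union[of P Q] by (auto simp: partition_on_def)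

lemma partition_on_filter:
  assumes P: "partition_on A P" and I: "I \<subseteq> A" and "\<And>B. B \<in> P \<Longrightarrow> B \<subseteq> I \<or> B \<inter> I = {}"
  shows "partition_on I {B \<in> P. B \<subseteq> I}"
proof -
  have "I \<subseteq> \<Union>{B \<in> P. B \<subseteq> I}"
  proof
    fix x assume x: "x \<in> I"
    then obtain B where "B \<in> P" "x \<in> B" using P I by (auto simp: partition_on_def)
    with assms(3)[of B] x have "B \<subseteq> I" by blast
    with \<open>B \<in> P\<close> \<open>x \<in> B\<close> show "x \<in> \<Union>{B \<in> P. B \<subseteq> I}" by blast
  qed
  moreover have "disjoint {B \<in> P. B \<subseteq> I}"
    using partition_onD2[OF P] by (rule pairwise_subset) blast
  moreover have "{} \<notin> {B \<in> P. B \<subseteq> I}" using partition_onD3[OF P] by blast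
  ultimately show ?thesis unfolding partition_on_def by blast
qed

text \<open>The point to check is that no pair \<open>x < c \<le> y\<close> of one colour is sealed.
  If \<open>x\<close> has the colour of \<open>a\<close>, then \<open>c\<close> has the other colour
  and its block reaches \<open>b - 1\<close>, so it is not confined below \<open>y\<close>.
  Otherwise \<open>c - 1\<close> has the other colour and its block reaches back to
  \<open>a \<le> x\<close>.\<close>

lemma biNC_Un:
  assumes P: "P \<in> biNC a c" and Q: "Q \<in> biNC c b" and odd: "odd (c - a)" "odd (b - c)"
  shows "P \<union> Q \<in> biNC a b"
proof (rule biNCI)
  note pP = biNC_partition[OF P] and pQ = biNC_partition[OF Q]
  have less: "a < c" "c < b" using odd by (auto intro: ccontr)
  have PB: "a \<le> x \<and> x < c \<and> a \<le> y \<and> y < c" if "linked P x y" for x y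
    using biNC_bounds[OF P that] .
  have QB: "c \<le> x \<and> x < b \<and> c \<le> y \<and> y < b" if "linked Q x y" for x y
    using biNC_bounds[OF Q that] .
  have "{a..<b} = {a..<c} \<union> {c..<b}" using less by auto
  moreover have "partition_on ({a..<c} \<union> {c..<b}) (P \<union> Q)"
    by (intro partition_on_Un pP pQ) auto
  ultimately show "partition_on {a..<b} (P \<union> Q)" by simp
  show "even (x + y)" if "linked (P \<union> Q) x y" for x y
    using that biNC_even[OF P] biNC_even[OF Q] unfolding linked_Un by blast
  show "x < v \<and> v < y"
    if h: "linked (P \<union> Q) x y" "linked (P \<union> Q) u v" "odd (x + u)" "x < u" "u < y" for x y u v
  proof -
    consider "linked P x y" | "linked Q x y" using h(1) unfolding linked_Un by blast
    then show ?thesis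
    proof cases
      case 1
      then have "\<not> linked Q u v" using PB[OF 1] QB[of u v] h(5) by auto
      then show ?thesis using biNC_nc[OF P 1 _ h(3-5)] h(2) unfolding linked_Un by blast
    next
      case 2
      then have "\<not> linked P u v" using QB[OF 2] PB[of u v] h(4) by auto
      then show ?thesis using biNC_nc[OF Q 2 _ h(3-5)] h(2) unfolding linked_Un by blast
    qed
  qed
  fix x y assume x: "a \<le> x" "x < y" "y < b" "even (x + y)" and s: "sealed (P \<union> Q) x y"
  have fl: "linked P a (c - 1)" "linked Q c (b - 1)"
    using biNC_first_last[OF P] biNC_first_last[OF Q] less odd by auto
  have sP: "sealed P x y" "sealed Q x y" using s unfolding sealed_def linked_Un by blast+
  consider "y < c" | "c \<le> x" | "x < c" "c \<le> y" by linarith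
  then show "linked (P \<union> Q) x y"
  proof cases
    case 1
    then show ?thesis using biNC_linkedI[OF P _ _ _ _ sP(1)] x unfolding linked_Un by blast
  next
    case 2
    then show ?thesis using biNC_linkedI[OF Q _ _ _ _ sP(2)] x unfolding linked_Un by blast
  next
    case 3
    have False
    proof (cases "even (a + x)")
      case True
      then have "even (a + y)" using x(4) by presburger
      then have "c \<noteq> y" using odd less by presburger
      moreover have "odd (x + c)" using True odd less by presburger
      moreover have "c < y" using \<open>c \<noteq> y\<close> 3 by simp
      ultimately have "b - 1 < y" using sP(2) fl(2) 3 unfolding sealed_def by blast
      then show ?thesis using x by simp
    next
      case False
      have "odd (x + (c - 1))" using False odd less by presburger
      then have "x \<noteq> c - 1" by presburger
      then have "x < c - 1" "c - 1 < y" using 3 less by auto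
      then have "x < a"
        using sP(1) linked_sym[OF fl(1)] \<open>odd (x + (c - 1))\<close> unfolding sealed_def by blast
      then show ?thesis using x by simp
    qed
    then show ?thesis ..
  qed
qed

text \<open>The cut \<open>c\<close> can be read off the union, because
  \<open>biNC_first_last\<close> puts \<open>c - 1\<close> into the block of
  \<open>a\<close>.\<close>

lemma Max_block_Un:
  assumes P: "P \<in> biNC a c" and Q: "Q \<in> biNC c b" and odd: "odd (c - a)" "odd (b - c)"
  shows "block_of (P \<union> Q) a = block_of P a" and "Max (block_of P a) = c - 1"
proof -
  have less: "a < c" using odd by (auto intro: ccontr)
  show "block_of (P \<union> Q) a = block_of P a"
    using biNC_bounds[OF Q, of a] less by (auto simp: block_of_def linked_Un)
  have "block_of P a \<subseteq> {a..<c}" using biNC_bounds[OF P] by (auto simp: block_of_def)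
  moreover have "c - 1 \<in> block_of P a"
    using biNC_first_last[OF P less odd(1)] by (simp add: block_of_def)
  ultimately show "Max (block_of P a) = c - 1"
    by (intro Max_eqI) (auto intro: finite_subset[of _ "{a..<c}"] simp: subset_iff)
qed

text \<open>The cut comes right after the last point \<open>i\<close> of the block of
  \<open>a\<close>. A block straddling it would leave the interval from \<open>a\<close> to
  \<open>i\<close> and cross the block of \<open>a\<close>. Both parts have odd length since
  \<open>i\<close> has the colour of \<open>a\<close> and \<open>b - 1\<close> has the other
  one.\<close>

lemma biNC_split:
  assumes P: "P \<in> biNC a b" and len: "even (b - a)" "a < b"
  defines "c \<equiv> Suc (Max (block_of P a))"
  shows "odd (c - a)" and "a < c" and "c < b" and "odd (b - c)"
    and "{B \<in> P. B \<subseteq> {a..<c}} \<in> biNC a c" and "{B \<in> P. B \<subseteq> {c..<b}} \<in> biNC c b"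
    and "{B \<in> P. B \<subseteq> {a..<c}} \<union> {B \<in> P. B \<subseteq> {c..<b}} = P"
proof -
  note pP = biNC_partition[OF P]
  define i where "i = Max (block_of P a)"
  have sub: "block_of P a \<subseteq> {a..<b}" using biNC_bounds[OF P] by (auto simp: block_of_def)
  then have fin: "finite (block_of P a)" by (rule finite_subset) simp
  have a: "a \<in> block_of P a" using in_block_of_self[OF pP] len by auto
  then have "i \<in> block_of P a" unfolding i_def using fin by (intro Max_in) auto
  then have li: "linked P a i" by (simp add: block_of_def)
  have maxi: "v \<le> i" if "linked P a v" for v
    using that fin unfolding i_def by (simp add: block_of_def)
  have ci: "c = Suc i" by (simp add: c_def i_def)
  have ai: "a \<le> i" "i < b" "even (a + i)" using biNC_bounds[OF P li] biNC_even[OF P li] by auto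
  show odd: "odd (c - a)" "a < c" using ai ci by auto
  have "i \<noteq> b - 1" using ai len by presburger
  then show "c < b" using ai ci by auto
  then show "odd (b - c)" using odd len by presburger
  have nostraddle: "v \<le> i" if uv: "linked P u v" and "u \<le> i" for u v
  proof (rule ccontr)
    assume "\<not> v \<le> i"
    then have v: "i < v" by simp
    have nl: "\<not> linked P a u" using maxi[of v] linked_trans[OF pP _ uv] v by force
    then have "u \<noteq> a" "u \<noteq> i" using li linked_refl[OF pP, of a] len by auto
    then have u: "a < u" "u < i" using biNC_bounds[OF P uv] \<open>u \<le> i\<close> by auto
    show False
    proof (cases "even (a + u)")
      case True
      then show ?thesis using biNC_noncrossing[OF P li uv] u v nl by auto
    next
      case False
      then show ?thesis using biNC_nc[OF P li uv] u v by auto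
    qed
  qed
  have dich: "B \<subseteq> {a..<c} \<or> B \<subseteq> {c..<b}" if "B \<in> P" for B
  proof -
    have "u \<in> {a..<b}" if "u \<in> B" for u
      using pP \<open>B \<in> P\<close> that by (auto simp: partition_on_def)
    moreover have "v \<le> i" if "u \<in> B" "v \<in> B" "u \<le> i" for u v
      using nostraddle[of u v] that \<open>B \<in> P\<close> by (auto simp: linked_def)
    ultimately show ?thesis unfolding ci subset_iff
      by (metis atLeastLessThan_iff less_Suc_eq_le not_less_eq_eq)
  qed
  then show un: "{B \<in> P. B \<subseteq> {a..<c}} \<union> {B \<in> P. B \<subseteq> {c..<b}} = P" by auto
  have "partition_on {a..<c} {B \<in> P. B \<subseteq> {a..<c}}"
    using dich \<open>c < b\<close> \<open>a < c\<close> by (intro partition_on_filter[OF pP]) fastforce+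
  then show "{B \<in> P. B \<subseteq> {a..<c}} \<in> biNC a c"
    by (intro biNC_restrict[OF P]) auto
  have "partition_on {c..<b} {B \<in> P. B \<subseteq> {c..<b}}"
    using dich \<open>c < b\<close> \<open>a < c\<close> by (intro partition_on_filter[OF pP]) fastforce+
  then show "{B \<in> P. B \<subseteq> {c..<b}} \<in> biNC c b"
    by (intro biNC_restrict[OF P]) auto
qed

lemma bij_betw_split:
  assumes len: "even (b - a)" "a < b"
  shows "bij_betw (\<lambda>(c, P, Q). P \<union> Q)
    (SIGMA c:{c \<in> {a..<b}. odd (c - a)}. biNC a c \<times> biNC c b) (biNC a b)"
proof (rule bij_betw_byWitness[where f' = "\<lambda>P. let c = Suc (Max (block_of P a)) in
      (c, {B \<in> P. B \<subseteq> {a..<c}}, {B \<in> P. B \<subseteq> {c..<b}})"])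
  let ?S = "SIGMA c:{c \<in> {a..<b}. odd (c - a)}. biNC a c \<times> biNC c b"
  have oddb: "odd (b - c)" if "c < b" "odd (c - a)" for c using that len by presburger
  show "(\<lambda>(c, P, Q). P \<union> Q) ` ?S \<subseteq> biNC a b"
    using biNC_Un oddb by auto
  show "(\<lambda>P. let c = Suc (Max (block_of P a)) in
      (c, {B \<in> P. B \<subseteq> {a..<c}}, {B \<in> P. B \<subseteq> {c..<b}})) ` biNC a b \<subseteq> ?S"
    using biNC_split[OF _ len] by (auto simp: Let_def less_imp_le)
  show "\<forall>P\<in>biNC a b. (\<lambda>(c, P, Q). P \<union> Q) (let c = Suc (Max (block_of P a)) in
      (c, {B \<in> P. B \<subseteq> {a..<c}}, {B \<in> P. B \<subseteq> {c..<b}})) = P"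
    using biNC_split(7)[OF _ len] by (auto simp: Let_def)
  show "\<forall>x\<in>?S. (let c = Suc (Max (block_of (case x of (c, P, Q) \<Rightarrow> P \<union> Q) a)) in
      (c, {B \<in> case x of (c, P, Q) \<Rightarrow> P \<union> Q. B \<subseteq> {a..<c}},
          {B \<in> case x of (c, P, Q) \<Rightarrow> P \<union> Q. B \<subseteq> {c..<b}})) = x"
  proof
    fix x assume "x \<in> ?S"
    then obtain c P Q where x: "x = (c, P, Q)" and c: "odd (c - a)" "c < b"
      and P: "P \<in> biNC a c" and Q: "Q \<in> biNC c b"
      by (cases x) auto
    have m: "Suc (Max (block_of (P \<union> Q) a)) = c"
      using Max_block_Un[OF P Q c(1) oddb[OF c(2,1)]] c by (cases c) auto
    have P': "B \<subseteq> {a..<c}" "B \<noteq> {}" if "B \<in> P" for B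
      using biNC_partition[OF P] that by (auto simp: partition_on_def)
    have Q': "B \<subseteq> {c..<b}" "B \<noteq> {}" if "B \<in> Q" for B
      using biNC_partition[OF Q] that by (auto simp: partition_on_def)
    have "\<not> (B \<subseteq> {a..<c} \<and> B \<subseteq> {c..<b})" if "B \<noteq> {}" for B using that by fastforce
    then have "{B \<in> P \<union> Q. B \<subseteq> {a..<c}} = P" "{B \<in> P \<union> Q. B \<subseteq> {c..<b}} = Q"
      using P' Q' unfolding set_eq_iff mem_Collect_eq Un_iff by meson+
    then show "(let c = Suc (Max (block_of (case x of (c, P, Q) \<Rightarrow> P \<union> Q) a)) in
      (c, {B \<in> case x of (c, P, Q) \<Rightarrow> P \<union> Q. B \<subseteq> {a..<c}},
          {B \<in> case x of (c, P, Q) \<Rightarrow> P \<union> Q. B \<subseteq> {c..<b}})) = x"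
      unfolding x prod.case m Let_def by simp
  qed
qed

section \<open>Adding a last point\<close>

lemma partition_on_image:
  assumes "partition_on A P" "inj_on f A"
  shows "partition_on (f ` A) ((`) f ` P)"
proof -
  have "{} \<notin> (`) f ` P" using partition_onD3[OF assms(1)] by auto
  then show ?thesis using partition_on_inj_image[OF assms] by simp
qed

lemma linked_image: "linked ((`) f ` P) x y \<longleftrightarrow> (\<exists>u v. linked P u v \<and> x = f u \<and> y = f v)"
  unfolding linked_def by blast

lemma linked_insert: "linked (insert B P) x y \<longleftrightarrow> x \<in> B \<and> y \<in> B \<or> linked P x y"
  by (auto simp: linked_def)

text \<open>This extension by a last point \<open>b\<close> is forced: on an interval of odd length,
  \<open>biNC_first_last\<close> puts the last point into the block of the first.\<close>

definition add_point :: "nat \<Rightarrow> nat \<Rightarrow> nat set set \<Rightarrow> nat set set" where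
  "add_point a b P = insert (insert b (block_of P a)) (P - {block_of P a})"

lemma linked_add_point:
  assumes "partition_on A P" "a \<in> A"
  shows "linked (add_point a b P) x y \<longleftrightarrow>
    linked P x y \<or> x = b \<and> y = b \<or> x = b \<and> linked P a y \<or> y = b \<and> linked P a x"
proof -
  have "linked P x y \<longleftrightarrow> linked (insert (block_of P a) (P - {block_of P a})) x y"
    using block_of_in[OF assms] by (simp add: insert_absorb)
  then have "linked P x y \<longleftrightarrow> linked P a x \<and> linked P a y \<or> linked (P - {block_of P a}) x y"
    unfolding linked_insert in_block_of_iff .
  then show ?thesis
    unfolding add_point_def linked_insert insert_iff in_block_of_iff by blast
qed

lemma partition_on_add_point:
  assumes P: "partition_on A P" and "a \<in> A" "b \<notin> A"
  shows "partition_on (insert b A) (add_point a b P)"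
proof -
  let ?B = "block_of P a"
  have B: "?B \<in> P" using block_of_in[OF P \<open>a \<in> A\<close>] .
  then have "?B \<subseteq> A" "?B \<noteq> {}" using P by (auto simp: partition_on_def)
  have disj: "disjnt ?B (\<Union>(P - {?B}))"
    using B P by (force simp: disjnt_def partition_on_def disjoint_def)
  then have "partition_on (A - ?B) (P - {?B})"
    using partition_on_insert[OF disj, of A] B P by (simp add: insert_absorb)
  moreover have "insert b A - insert b ?B = A - ?B" using \<open>b \<notin> A\<close> by auto
  moreover have "disjnt (insert b ?B) (\<Union>(P - {?B}))"
    using disj P \<open>b \<notin> A\<close> by (auto simp: disjnt_def partition_on_def)
  ultimately show ?thesis
    unfolding add_point_def using \<open>?B \<subseteq> A\<close> by (subst partition_on_insert) auto
qed

text \<open>Let \<open>x\<close> have the colour of \<open>a\<close> and \<open>b\<close>. The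
  points of the other colour lie either between \<open>a\<close> and \<open>x\<close> or between
  \<open>x\<close> and \<open>b\<close>, and one of these parts is a union of blocks iff the other
  is. So the pair \<open>x\<close>, \<open>b\<close> is sealed exactly when \<open>x\<close> belongs
  to the block of \<open>a\<close>.\<close>

lemma biNC_add_point:
  assumes P: "P \<in> biNC a b" and len: "even (b - a)" "a < b"
  shows "add_point a b P \<in> biNC a (Suc b)"
proof (rule biNCI)
  note pP = biNC_partition[OF P]
  have aA: "a \<in> {a..<b}" using len by simp
  note L = linked_add_point[OF pP aA, of b]
  have PB: "a \<le> x \<and> x < b \<and> a \<le> y \<and> y < b" if "linked P x y" for x y
    using biNC_bounds[OF P that] .
  have eab: "even (a + b)" using len by presburger
  have "insert b {a..<b} = {a..<Suc b}" using len by auto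
  then show "partition_on {a..<Suc b} (add_point a b P)"
    using partition_on_add_point[OF pP aA, of b] by simp
  show "even (x + y)" if "linked (add_point a b P) x y" for x y
  proof -
    have "even (b + z)" if "linked P a z" for z
      using biNC_even[OF P that] eab by presburger
    then show ?thesis using that biNC_even[OF P, of x y] unfolding L
      by (elim disjE conjE) (simp_all add: add.commute)
  qed
  show "x < v \<and> v < y" if h: "linked (add_point a b P) x y" "linked (add_point a b P) u v"
    "odd (x + u)" "x < u" "u < y" for x y u v
  proof -
    have "u < b" using h(1,5) PB[of x y] PB[of a y] PB[of a x] unfolding L by auto
    have "x < b" using \<open>u < b\<close> h by simp
    have uv: "linked P u v \<or> v = b \<and> linked P a u" using h(2) \<open>u < b\<close> unfolding L by auto
    have xy: "linked P x y \<or> y = b \<and> linked P a x" using h(1) \<open>x < b\<close> unfolding L by auto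
    show ?thesis
    proof (cases "linked P x y")
      case True
      show ?thesis
      proof (cases "linked P u v")
        case False
        then have "linked P u a" using uv linked_sym by blast
        from biNC_nc[OF P True this h(3-5)] have "x < a" by simp
        then show ?thesis using PB[OF True] by simp
      qed (use biNC_nc[OF P True _ h(3-5)] in blast)
    next
      case False
      then have y: "y = b" and ax: "linked P a x" using xy by auto
      have par: "odd (a + u)" using biNC_even[OF P ax] h(3) by presburger
      then have "\<not> linked P a u" using biNC_even[OF P, of a u] by blast
      then have uv: "linked P u v" using uv by blast
      have "even (u + v)" "a \<le> v" "v < b" using biNC_even[OF P uv] PB[OF uv] by auto
      have "\<not> v \<le> x"
      proof
        assume "v \<le> x"
        moreover have "v \<noteq> x" "v \<noteq> a" using par h(3) \<open>even (u + v)\<close> by presburger+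
        ultimately have "a < v" "v < x" using \<open>a \<le> v\<close> by auto
        moreover have "odd (a + v)" using par \<open>even (u + v)\<close> by presburger
        ultimately have "u < x" using biNC_nc[OF P ax linked_sym[OF uv]] by blast
        then show False using h by simp
      qed
      then show ?thesis using y \<open>v < b\<close> by simp
    qed
  qed
  fix x y assume x: "a \<le> x" "x < y" "y < Suc b" "even (x + y)"
    and s: "sealed (add_point a b P) x y"
  show "linked (add_point a b P) x y"
  proof (cases "y = b")
    case False
    have "sealed P x y" using s unfolding sealed_def L by blast
    then show ?thesis using biNC_linkedI[OF P] x False unfolding L by auto
  next
    case y: True
    show ?thesis
    proof (cases "x = a")
      case True
      then show ?thesis using y linked_refl[OF pP aA] unfolding L by simp
    next
      case False
      have "even (a + x)" using x eab y by presburger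
      have "sealed P a x" unfolding sealed_def
      proof (intro allI impI)
        fix u v assume u: "linked P u v" "odd (a + u)" "a < u" "u < x"
        have "even (u + v)" "a \<le> v" "v < b" using biNC_even[OF P u(1)] PB[OF u(1)] by auto
        then have ne: "v \<noteq> a" "v \<noteq> x" using u(2) \<open>even (a + x)\<close> by presburger+
        have "\<not> x < v"
        proof
          assume "x < v"
          moreover have "odd (x + v)" using \<open>even (u + v)\<close> \<open>even (a + x)\<close> u(2) by presburger
          moreover have "linked (add_point a b P) v u" using linked_sym[OF u(1)] unfolding L by simp
          ultimately have "x < u" using s \<open>v < b\<close> y unfolding sealed_def by blast
          then show False using u by simp
        qed
        then show "a < v \<and> v < x" using ne \<open>a \<le> v\<close> by simp
      qed
      then have "linked P a x" using biNC_linkedI[OF P] False x \<open>even (a + x)\<close> y by auto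
      then show ?thesis using y unfolding L by simp
    qed
  qed
qed

lemma bij_betw_add_point:
  assumes len: "even (b - a)" "a < b"
  shows "bij_betw (add_point a b) (biNC a b) (biNC a (Suc b))"
proof -
  \<comment> \<open>The inverse map. Deleting \<open>b\<close> leaves no empty block behind, because
    \<open>b\<close> shares its block with \<open>a\<close>.\<close>
  define del where "del P = (\<lambda>B. B - {b}) ` P" for P :: "nat set set"
  have lb: "linked P a b" "linked P b a" if "P \<in> biNC a (Suc b)" for P
  proof -
    have "odd (Suc b - a)" using len by presburger
    then show "linked P a b" using biNC_first_last[OF that] len by simp
    then show "linked P b a" by (rule linked_sym)
  qed
  have Ld: "linked (del P) x y \<longleftrightarrow> linked P x y \<and> x \<noteq> b \<and> y \<noteq> b" for P x y
    by (auto simp: linked_def del_def)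
  have pd: "partition_on {a..<b} (del P)" if P: "P \<in> biNC a (Suc b)" for P
  proof -
    note pP = biNC_partition[OF P]
    have "B \<noteq> {b}" if "B \<in> P" for B
      using lb[OF P] partition_eq_block[OF pP that, of b] len by (auto simp: block_of_def)
    then have "B - {b} \<noteq> {}" if "B \<in> P" for B
      using partition_onD3[OF pP] that subset_singletonD[of B b] by auto
    then have "{} \<notin> del P" unfolding del_def by force
    moreover have "\<Union>(del P) = {a..<Suc b} - {b}"
      using partition_onD1[OF pP] unfolding del_def by auto
    moreover have "{a..<Suc b} - {b} = {a..<b}" by auto
    moreover have "disjoint (del P)"
    proof (rule disjointI)
      fix p q assume "p \<in> del P" "q \<in> del P" "p \<noteq> q"
      then obtain B C where "p = B - {b}" "q = C - {b}" "B \<in> P" "C \<in> P" "B \<noteq> C"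
        unfolding del_def by auto
      then show "p \<inter> q = {}" using disjointD[OF partition_onD2[OF pP], of B C] by auto
    qed
    ultimately show ?thesis unfolding partition_on_def by simp
  qed
  have delin: "del P \<in> biNC a b" if P: "P \<in> biNC a (Suc b)" for P
  proof (rule biNCI)
    note pP = biNC_partition[OF P]
    show "partition_on {a..<b} (del P)" by (rule pd[OF P])
    show "even (x + y)" if "linked (del P) x y" for x y
      using that biNC_even[OF P, of x y] unfolding Ld by blast
    show "x < v \<and> v < y" if "linked (del P) x y" "linked (del P) u v"
    "odd (x + u)" "x < u" "u < y" for x y u v
      using biNC_nc[OF P, of x y u v] that unfolding Ld by blast
    fix x y assume x: "a \<le> x" "x < y" "y < b" "even (x + y)" and s: "sealed (del P) x y"
    have "sealed P x y" unfolding sealed_def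
    proof (intro allI impI)
      fix u v assume u: "linked P u v" "odd (x + u)" "x < u" "u < y"
      have *: "x < v \<and> v < y" if "linked P u v" "v \<noteq> b" for v
      proof -
        have "u \<noteq> b" using u x by simp
        with that have "linked (del P) u v" unfolding Ld by blast
        then show ?thesis using s u(2-4) unfolding sealed_def by blast
      qed
      \<comment> \<open>A block that reaches \<open>b\<close> also contains \<open>a\<close>, and
        \<open>*\<close> applied to \<open>a\<close> would give \<open>x < a\<close>.\<close>
      have "v \<noteq> b"
      proof
        assume "v = b"
        then have "linked P u a" using linked_trans[OF pP] u(1) lb[OF P] by blast
        then show False using * x len by fastforce
      qed
      then show "x < v \<and> v < y" using *[OF u(1)] by blast
    qed
    then show "linked (del P) x y" using biNC_linkedI[OF P] x unfolding Ld by auto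
  qed
  show ?thesis
  proof (rule bij_betw_byWitness[where f' = del])
    have aA: "a \<in> {a..<b}" using len by simp
    have ins: "insert b {a..<b} = {a..<Suc b}" using len by auto
    show "\<forall>P\<in>biNC a b. del (add_point a b P) = P"
    proof
      fix P assume P: "P \<in> biNC a b"
      note pP = biNC_partition[OF P]
      show "del (add_point a b P) = P"
      proof (rule partition_eqI[OF pd[OF biNC_add_point[OF P len]] pP])
        show "linked (del (add_point a b P)) x y \<longleftrightarrow> linked P x y" for x y
          unfolding Ld linked_add_point[OF pP aA] using linked_in[OF pP, of x y] by auto
      qed
    qed
    show "\<forall>P\<in>biNC a (Suc b). add_point a b (del P) = P"
    proof
      fix P assume P: "P \<in> biNC a (Suc b)"
      note pP = biNC_partition[OF P]
      show "add_point a b (del P) = P"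
      proof (rule partition_eqI[OF _ pP])
        show "partition_on {a..<Suc b} (add_point a b (del P))"
          using partition_on_add_point[OF pd[OF P] aA, of b] ins by simp
        have ab: "a \<noteq> b" using len by simp
        have "linked P b y \<longleftrightarrow> linked P a y" "linked P y b \<longleftrightarrow> linked P a y" for y
          using linked_trans[OF pP, of a b y] linked_trans[OF pP, of b a y]
            linked_sym[of P y b] linked_sym[of P b y] lb[OF P] by blast+
        moreover have "linked P b b" using linked_trans[OF pP lb(2)[OF P] lb(1)[OF P]] .
        ultimately show "linked (add_point a b (del P)) x y \<longleftrightarrow> linked P x y" for x y
          unfolding linked_add_point[OF pd[OF P] aA] Ld using ab by metis
      qed
    qed
  qed (use biNC_add_point[OF _ len] delin in auto)
qed

section \<open>Translation and rotation\<close>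

text \<open>All conditions speak of the order of points and of the parity of sums of two points, and
  neither changes when every point moves by one.\<close>

lemma biNC_Suc_iff:
  assumes "partition_on {a..<b} P" and "partition_on {Suc a..<Suc b} Q"
    and L: "\<And>x y. linked Q (Suc x) (Suc y) \<longleftrightarrow> linked P x y"
  shows "Q \<in> biNC (Suc a) (Suc b) \<longleftrightarrow> P \<in> biNC a b"
proof -
  have Q: "\<exists>u. x = Suc u" if "linked Q x y" for x y
    using linked_in[OF assms(2) that] by (cases x) auto
  have allQ: "(\<forall>x y. linked Q x y \<longrightarrow> A x y) \<longleftrightarrow> (\<forall>x y. linked P x y \<longrightarrow> A (Suc x) (Suc y))" for A
    using L Q linked_sym by metis
  have "sealed Q (Suc x) (Suc y) \<longleftrightarrow> sealed P x y" for x y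
    unfolding sealed_def allQ by simp
  moreover have "(\<forall>x y. Suc a \<le> x \<longrightarrow> x < y \<longrightarrow> A x y) \<longleftrightarrow> (\<forall>x y. a \<le> x \<longrightarrow> x < y \<longrightarrow> A (Suc x) (Suc y))" for A
    by (metis Suc_le_D Suc_le_mono Suc_lessE Suc_less_eq)
  note this[of "\<lambda>x y. y < Suc b \<longrightarrow> even (x + y) \<longrightarrow> (linked Q x y \<longleftrightarrow> sealed Q x y)"]
  ultimately show ?thesis
    unfolding biNC_def mem_Collect_eq allQ using assms by simp
qed

lemma biNC_Suc: "biNC (Suc a) (Suc b) = (`) ((`) Suc) ` biNC a b"
proof (intro set_eqI iffI)
  fix Q assume "Q \<in> (`) ((`) Suc) ` biNC a b"
  then obtain P where P: "P \<in> biNC a b" and Q: "Q = (`) Suc ` P" by auto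
  have "partition_on {Suc a..<Suc b} Q"
    using partition_on_image[OF biNC_partition[OF P], of Suc] Q by simp
  then show "Q \<in> biNC (Suc a) (Suc b)"
    using biNC_Suc_iff[OF biNC_partition[OF P], of Q] P Q by (simp add: linked_image)
next
  fix Q assume Q: "Q \<in> biNC (Suc a) (Suc b)"
  define P where "P = (`) (\<lambda>x. x - 1) ` Q"
  note pQ = biNC_partition[OF Q]
  have inj: "inj_on (\<lambda>x. x - 1) {Suc a..<Suc b}" by (auto simp: inj_on_def)
  have "(\<lambda>x. x - 1) ` {Suc a..<Suc b} = {a..<b}"
    by (auto simp: image_iff intro!: bexI[of _ "Suc _"])
  then have pP: "partition_on {a..<b} P"
    using partition_on_image[OF pQ inj] unfolding P_def by simp
  have L: "linked Q (Suc x) (Suc y) \<longleftrightarrow> linked P x y" for x y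
    unfolding P_def linked_image using linked_in[OF pQ]
    by (metis One_nat_def Suc_pred atLeastLessThan_iff diff_Suc_1 less_eq_Suc_le zero_less_Suc less_le_trans)
  have "(`) Suc ` P = Q"
  proof (rule partition_eqI[OF _ pQ])
    show "partition_on {Suc a..<Suc b} ((`) Suc ` P)" using partition_on_image[OF pP, of Suc] by simp
    show "linked ((`) Suc ` P) x y \<longleftrightarrow> linked Q x y" for x y
      unfolding linked_image using L linked_in[OF pQ, of x y] by (cases x; cases y) auto
  qed
  then show "Q \<in> (`) ((`) Suc) ` biNC a b"
    using biNC_Suc_iff[OF pP pQ L] Q by blast
qed

lemma inj_image_Suc: "inj ((`) ((`) Suc))"
  by (intro inj_on_image inj_on_subset[OF inj_Suc]) auto

lemma card_biNC_Suc: "card (biNC (Suc a) (Suc b)) = card (biNC a b)"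
  unfolding biNC_Suc by (rule card_image) (rule inj_on_subset[OF inj_image_Suc], simp)

section \<open>Rotation of the circle by moving the first point to the end\<close>

definition rename :: "nat \<Rightarrow> nat \<Rightarrow> nat set set \<Rightarrow> nat set set" where
  "rename a b P = (`) (\<lambda>x. if x = a then b else x) ` P"

text \<open>As \<open>b - a\<close> is even, the moved point keeps its colour. A chord from it to
  \<open>x\<close> cuts the circle into two arcs, and the points of the other colour on one arc form
  a union of blocks iff those on the other arc do. So sealing of \<open>x\<close> and
  \<open>b\<close> after the rotation amounts to sealing of \<open>a\<close> and \<open>x\<close>
  before it.\<close>

lemma biNC_rename:
  assumes P: "P \<in> biNC a b" and len: "even (b - a)" "a < b"
  shows "rename a b P \<in> biNC (Suc a) (Suc b)"
proof (rule biNCI)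
  note pP = biNC_partition[OF P]
  have PB: "a \<le> x \<and> x < b \<and> a \<le> y \<and> y < b" if "linked P x y" for x y
    using biNC_bounds[OF P that] .
  have L: "linked (rename a b P) x y \<longleftrightarrow> linked P x y \<and> x \<noteq> a \<and> y \<noteq> a \<or> x = b \<and> y = b
     \<or> x = b \<and> y \<noteq> a \<and> linked P a y \<or> y = b \<and> x \<noteq> a \<and> linked P a x" for x y
  proof -
    let ?r = "\<lambda>x. if x = a then b else x"
    have laa: "linked P a a" using linked_refl[OF pP] len by simp
    have nb: "\<not> linked P b z" "\<not> linked P z b" for z using PB[of b z] PB[of z b] by auto
    show ?thesis (is "_ \<longleftrightarrow> ?R")
    proof
      assume "linked (rename a b P) x y"
      then obtain u v where uv: "linked P u v" "x = ?r u" "y = ?r v"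
        unfolding rename_def linked_image by blast
      show ?R using uv linked_sym[OF uv(1)] len(2) by auto
    next
      assume R: ?R
      let ?s = "\<lambda>x. if x = b then a else x"
      have "linked P (?s x) (?s y)" "x = ?r (?s x)" "y = ?r (?s y)"
        using R laa nb linked_sym[of P a] len(2) by auto
      then show "linked (rename a b P) x y"
        unfolding rename_def linked_image by blast
    qed
  qed
  have eab: "even (a + b)" using len by presburger
  have inj: "inj_on (\<lambda>x. if x = a then b else x) {a..<b}" by (auto simp: inj_on_def)
  have "(\<lambda>x. if x = a then b else x) ` {a..<b} = {Suc a..<Suc b}"
    using len by (auto simp: image_iff less_Suc_eq)
  then show "partition_on {Suc a..<Suc b} (rename a b P)"
    using partition_on_image[OF pP inj] unfolding rename_def by simp
  show "even (x + y)" if "linked (rename a b P) x y" for x y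
  proof -
    have "even (b + z)" if "linked P a z" for z
      using biNC_even[OF P that] eab by presburger
    then show ?thesis using that biNC_even[OF P, of x y] unfolding L
      by (elim disjE conjE) (simp_all add: add.commute)
  qed
  show "x < v \<and> v < y" if h: "linked (rename a b P) x y" "linked (rename a b P) u v"
    "odd (x + u)" "x < u" "u < y" for x y u v
  proof -
    have "u < b" using h(1,5) PB[of x y] PB[of a y] PB[of a x] unfolding L by auto
    have "x < b" using \<open>u < b\<close> h by simp
    have xa: "a < x" using h(1) PB[of x y] PB[of a x] \<open>x < b\<close> unfolding L by auto
    have uv: "linked P u v \<and> v \<noteq> a \<or> v = b \<and> linked P a u" using h(2) \<open>u < b\<close> unfolding L by auto
    have xy: "linked P x y \<or> y = b \<and> linked P a x" using h(1) \<open>x < b\<close> unfolding L by auto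
    show ?thesis
    proof (cases "linked P x y")
      case True
      show ?thesis
      proof (cases "linked P u v")
        case False
        then have "linked P u a" using uv linked_sym by blast
        from biNC_nc[OF P True this h(3-5)] have "x < a" by simp
        then show ?thesis using PB[OF True] by simp
      qed (use biNC_nc[OF P True _ h(3-5)] in blast)
    next
      case False
      then have y: "y = b" and ax: "linked P a x" using xy by auto
      have par: "odd (a + u)" using biNC_even[OF P ax] h(3) by presburger
      then have "\<not> linked P a u" using biNC_even[OF P, of a u] by blast
      then have uv: "linked P u v" using uv by blast
      have "even (u + v)" "a \<le> v" "v < b" using biNC_even[OF P uv] PB[OF uv] by auto
      have "\<not> v \<le> x"
      proof
        assume "v \<le> x"
        moreover have "v \<noteq> x" "v \<noteq> a" using par h(3) \<open>even (u + v)\<close> by presburger+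
        ultimately have "a < v" "v < x" using \<open>a \<le> v\<close> by auto
        moreover have "odd (a + v)" using par \<open>even (u + v)\<close> by presburger
        ultimately have "u < x" using biNC_nc[OF P ax linked_sym[OF uv]] by blast
        then show False using h by simp
      qed
      then show ?thesis using y \<open>v < b\<close> by simp
    qed
  qed
  fix x y assume x: "Suc a \<le> x" "x < y" "y < Suc b" "even (x + y)"
    and s: "sealed (rename a b P) x y"
  show "linked (rename a b P) x y"
  proof (cases "y = b")
    case False
    have "sealed P x y" unfolding sealed_def
    proof (intro allI impI)
      fix u v assume u: "linked P u v" "odd (x + u)" "x < u" "u < y"
      have "v \<noteq> a"
      proof
        assume "v = a"
        then have "linked (rename a b P) u b" using linked_sym[OF u(1)] u(3) x(1) unfolding L by auto
        then have "b < y" using s u(2-4) unfolding sealed_def by blast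
        then show False using x by simp
      qed
      then have "linked (rename a b P) u v" using u(1,3) x(1) unfolding L by auto
      then show "x < v \<and> v < y" using s u(2-4) unfolding sealed_def by blast
    qed
    then show ?thesis using biNC_linkedI[OF P] x False unfolding L by auto
  next
    case y: True
    have "even (a + x)" using x eab y by presburger
    have "sealed P a x" unfolding sealed_def
    proof (intro allI impI)
      fix u v assume u: "linked P u v" "odd (a + u)" "a < u" "u < x"
      have "even (u + v)" "a \<le> v" "v < b" using biNC_even[OF P u(1)] PB[OF u(1)] by auto
      then have ne: "v \<noteq> a" "v \<noteq> x" using u(2) \<open>even (a + x)\<close> by presburger+
      have "\<not> x < v"
      proof
        assume "x < v"
        moreover have "odd (x + v)" using \<open>even (u + v)\<close> \<open>even (a + x)\<close> u(2) by presburger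
        moreover have "linked (rename a b P) v u" using linked_sym[OF u(1)] u(3) ne unfolding L by simp
        ultimately have "x < u" using s \<open>v < b\<close> y unfolding sealed_def by blast
        then show False using u by simp
      qed
      then show "a < v \<and> v < x" using ne \<open>a \<le> v\<close> by simp
    qed
    then have "linked P a x" using biNC_linkedI[OF P] x \<open>even (a + x)\<close> y by auto
    then show ?thesis using y x(1) unfolding L by auto
  qed
qed

lemma inj_on_rename: "inj_on (rename a b) (biNC a b)"
proof (rule inj_onI)
  fix P Q assume P: "P \<in> biNC a b" and Q: "Q \<in> biNC a b" and eq: "rename a b P = rename a b Q"
  have inj: "inj_on (\<lambda>x. if x = a then b else x) {a..<b}" by (auto simp: inj_on_def)
  have "P \<subseteq> Pow {a..<b}" "Q \<subseteq> Pow {a..<b}"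
    using biNC_partition[OF P] biNC_partition[OF Q] by (auto simp: partition_on_def)
  then show "P = Q"
    using inj_on_image_eq_iff[OF inj_on_image_Pow[OF inj], of P Q] eq unfolding rename_def by blast
qed

text \<open>Injectivity suffices, because both sides have the same cardinality by translation.\<close>
lemma bij_betw_rename:
  assumes "even (b - a)" "a < b"
  shows "bij_betw (rename a b) (biNC a b) (biNC (Suc a) (Suc b))"
  using inj_on_rename biNC_rename[OF _ assms]
  by (intro bij_betw_imageI card_subset_eq) (auto simp: finite_biNC card_image card_biNC_Suc)

section \<open>The Kreweras dual via separated points\<close>

lemma linked_quotient:
  assumes "equiv A r"
  shows "linked (A // r) x y \<longleftrightarrow> (x, y) \<in> r"
proof
  assume "linked (A // r) x y"
  then obtain X where "X \<in> A // r" "x \<in> X" "y \<in> X" by (auto simp: linked_def)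
  then show "(x, y) \<in> r" using quotient_eq_iff[OF assms, of X X x y] by simp
next
  assume r: "(x, y) \<in> r"
  then have "x \<in> A" using assms by (auto simp: equiv_def refl_on_def)
  then have "r `` {x} \<in> A // r" "x \<in> r `` {x}" using equiv_class_self[OF assms] by (auto intro: quotientI)
  then show "linked (A // r) x y" using r by (auto simp: linked_def)
qed

lemma noncrossingD:
  assumes "noncrossing P" "linked P i k" "linked P j l" "i < j" "j < k" "k < l"
  shows "linked P i j"
proof -
  obtain B C where *: "B \<in> P" "i \<in> B" "k \<in> B" "C \<in> P" "j \<in> C" "l \<in> C"
    using assms(2,3) by (auto simp: linked_def)
  have "B = C"
  proof (rule ccontr)
    assume "B \<noteq> C"
    then have "\<exists>B\<in>P. \<exists>C\<in>P. B \<noteq> C \<and> (\<exists>i\<in>B. \<exists>j\<in>C. \<exists>k\<in>B. \<exists>l\<in>C. i < j \<and> j < k \<and> k < l)"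
      using * assms(4-6) by (intro bexI[of _ B] bexI[of _ C] conjI bexI[of _ i] bexI[of _ j] bexI[of _ k] bexI[of _ l])
    then show False using assms(1) unfolding noncrossing_def by contradiction
  qed
  then show ?thesis using * by (auto simp: linked_def)
qed

lemma noncrossingI:
  assumes "partition_on A P"
    and "\<And>i j k l. linked P i k \<Longrightarrow> linked P j l \<Longrightarrow> i < j \<Longrightarrow> j < k \<Longrightarrow> k < l \<Longrightarrow> linked P i j"
  shows "noncrossing P"
  unfolding noncrossing_def
proof clarify
  fix B C i j k l
  assume *: "B \<in> P" "C \<in> P" "B \<noteq> C" "i \<in> B" "j \<in> C" "k \<in> B" "l \<in> C" "i < j" "j < k" "k < l"
  then have "linked P i k" "linked P j l" by (auto simp: linked_def)
  then have "linked P i j" using assms(2) * by blast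
  then have "block_of P i = block_of P j"
    using linked_trans[OF assms(1)] linked_sym unfolding block_of_def by blast
  then show False using partition_eq_block[OF assms(1)] * by metis
qed

text \<open>For \<open>i < j\<close>: the set \<open>{i<..j}\<close> is a union of blocks.  This symmetric form is preserved under
  symmetric differences, so that transitivity is propositional.\<close>
definition separated :: "nat set set \<Rightarrow> nat \<Rightarrow> nat \<Rightarrow> bool" where
  "separated P i j \<longleftrightarrow> (\<forall>u v. linked P u v \<longrightarrow> ((u \<le> i \<longleftrightarrow> u \<le> j) \<longleftrightarrow> (v \<le> i \<longleftrightarrow> v \<le> j)))"

lemma separated_less_iff:
  assumes "i < j"
  shows "separated P i j \<longleftrightarrow> (\<forall>u v. linked P u v \<longrightarrow> i < u \<longrightarrow> u \<le> j \<longrightarrow> i < v \<and> v \<le> j)"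
proof -
  have *: "(u \<le> i \<longleftrightarrow> u \<le> j) \<longleftrightarrow> \<not> (i < u \<and> u \<le> j)" for u using assms by auto
  show ?thesis unfolding separated_def * using linked_sym by blast
qed

text \<open>The dual points \<open>i'\<close> and \<open>j'\<close> enclose the points
  \<open>i + 1, ..., j\<close>, and the chord between them crosses no block of \<open>P\<close>
  exactly when \<open>separated P i j\<close>. Joining all such pairs gives the candidate for the
  coarsest partition.\<close>

definition kreweras_rel :: "nat \<Rightarrow> nat set set \<Rightarrow> (nat \<times> nat) set" where
  "kreweras_rel n P = {(i, j). i \<in> {1..n} \<and> j \<in> {1..n} \<and> separated P i j}"

lemma equiv_kreweras_rel: "equiv {1..n} (kreweras_rel n P)"
proof (rule equivI)
  show "kreweras_rel n P \<subseteq> {1..n} \<times> {1..n}" by (auto simp: kreweras_rel_def)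
  show "refl_on {1..n} (kreweras_rel n P)"
    by (auto simp: kreweras_rel_def refl_on_def separated_def)
  have "separated P j i" if "separated P i j" for i j
    using that unfolding separated_def by blast
  then show "sym (kreweras_rel n P)"
    by (auto simp: kreweras_rel_def sym_def)
  have "separated P i k" if "separated P i j" "separated P j k" for i j k
    unfolding separated_def
  proof (intro allI impI)
    fix u v assume "linked P u v"
    then have "(u \<le> i \<longleftrightarrow> u \<le> j) \<longleftrightarrow> (v \<le> i \<longleftrightarrow> v \<le> j)" "(u \<le> j \<longleftrightarrow> u \<le> k) \<longleftrightarrow> (v \<le> j \<longleftrightarrow> v \<le> k)"
      using that unfolding separated_def by blast+
    then show "(u \<le> i \<longleftrightarrow> u \<le> k) \<longleftrightarrow> (v \<le> i \<longleftrightarrow> v \<le> k)" by argo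
  qed
  then show "trans (kreweras_rel n P)"
    unfolding trans_def kreweras_rel_def by blast
qed

lemma linked_interleave: "linked (interleave P Q) x y \<longleftrightarrow>
    (\<exists>i j. linked P i j \<and> x = 2 * i - 1 \<and> y = 2 * j - 1) \<or>
    (\<exists>i j. linked Q i j \<and> x = 2 * i \<and> y = 2 * j)"
  unfolding interleave_def linked_Un linked_image ..

lemma partition_on_interleave:
  assumes P: "partition_on {1..n} P" and Q: "partition_on {1..n} Q"
  shows "partition_on {1..<2 * n + 1} (interleave P Q)"
proof -
  let ?o = "\<lambda>i::nat. 2 * i - 1" and ?e = "\<lambda>i::nat. 2 * i"
  have "x \<in> ?o ` {1..n} \<union> ?e ` {1..n}" if "x \<in> {1..<2 * n + 1}" for x
  proof (cases "even x")
    case True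
    then obtain k where "x = 2 * k" by blast
    then show ?thesis using that by auto
  next
    case False
    then obtain k where "x = 2 * k + 1" by (rule oddE)
    then have "x = ?o (Suc k)" "Suc k \<in> {1..n}" using that by auto
    then show ?thesis by blast
  qed
  moreover have "?o ` {1..n} \<union> ?e ` {1..n} \<subseteq> {1..<2 * n + 1}" by auto
  ultimately have un: "?o ` {1..n} \<union> ?e ` {1..n} = {1..<2 * n + 1}" by blast
  have "?o i \<noteq> ?e j" if "i \<in> {1..n}" for i j
    using that by auto presburger
  then have "?o ` {1..n} \<inter> ?e ` {1..n} = {}" by blast
  then have "partition_on (?o ` {1..n} \<union> ?e ` {1..n}) (interleave P Q)"
    unfolding interleave_def
    by (intro partition_on_Un partition_on_image[OF P] partition_on_image[OF Q]) (auto simp: inj_on_def)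
  then show ?thesis unfolding un .
qed

text \<open>The form \<open>2 * i + 1\<close> avoids truncated subtraction, under which
  \<open>2 * 0 - 1\<close> is even. The partition of \<open>{1..n}\<close> excludes this value here
  and in \<open>linked_interleave_even\<close>.\<close>

lemma linked_interleave_odd:
  assumes "partition_on {1..n} P"
  shows "linked (interleave P Q) (2 * i + 1) (2 * j + 1) \<longleftrightarrow> linked P (Suc i) (Suc j)"
proof -
  have "i' = Suc i" if "linked P i' j'" "2 * i + 1 = 2 * i' - 1" for i i' j'
    using that(2) linked_in[OF assms that(1)] by auto
  then show ?thesis
    unfolding linked_interleave using linked_sym[of P]
    by (smt (verit) Suc_eq_plus1 add_diff_cancel_right' add_mult_distrib2 even_add even_mult_iff
        mult_2 mult_Suc_right odd_one add_2_eq_Suc add_Suc_right plus_1_eq_Suc diff_Suc_1)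
qed

lemma linked_interleave_even:
  assumes "partition_on {1..n} P"
  shows "linked (interleave P Q) (2 * i) (2 * j) \<longleftrightarrow> linked Q i j"
proof -
  have "2 * i \<noteq> 2 * i' - 1" if "linked P i' j'" for i' j'
    using linked_in[OF assms that] by auto presburger
  then show ?thesis unfolding linked_interleave by auto
qed

text \<open>A block of \<open>P\<close> that leaves \<open>{i<..j}\<close> crosses the chord from
  \<open>2 * i\<close> to \<open>2 * j\<close>. Being noncrossing would then link an odd to an even
  point, but the blocks of an interleaving have one colour.\<close>

lemma separated_if_noncrossing_interleave:
  assumes P: "partition_on {1..n} P" and R: "partition_on {1..n} R"
    and nc: "noncrossing (interleave P R)" and l: "linked R i j" and "i < j"
  shows "separated P i j"
  unfolding separated_less_iff[OF \<open>i < j\<close>]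
proof (intro allI impI)
  fix u v assume uv: "linked P u v" and u: "i < u" "u \<le> j"
  let ?M = "interleave P R"
  have pos: "u \<ge> 1" "v \<ge> 1" "i \<ge> 1" using linked_in[OF P uv] linked_in[OF R l] by auto
  have M: "linked ?M (2 * u - 1) (2 * v - 1)" "linked ?M (2 * v - 1) (2 * u - 1)"
     "linked ?M (2 * i) (2 * j)"
    using uv l linked_sym[OF uv] unfolding linked_interleave by blast+
  have par: "even x \<longleftrightarrow> even y" if "linked ?M x y" for x y
    using that linked_in[OF P] unfolding linked_interleave by (auto; force)
  have "\<not> v \<le> i"
  proof
    assume "v \<le> i"
    then have "linked ?M (2 * v - 1) (2 * i)"
      using noncrossingD[OF nc M(2,3)] u pos by auto
    then show False using par pos by fastforce
  qed
  moreover have "\<not> j < v"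
  proof
    assume "j < v"
    then have "linked ?M (2 * i) (2 * u - 1)"
      using noncrossingD[OF nc M(3,1)] u pos by auto
    then show False using par pos by fastforce
  qed
  ultimately show "i < v \<and> v \<le> j" by simp
qed

text \<open>The Kreweras dual determines the partition: consecutive elements \<open>m < m'\<close> of a block of
  \<open>P\<close> give dual points \<open>m\<close> and \<open>m' - 1\<close> in one block of the dual, and so do the last and the
  first element of a block, cyclically.\<close>
lemma linked_if_dual_sealed:
  assumes P: "partition_on {1..n} P" and nc: "noncrossing P"
    and ij: "1 \<le> i" "i < j" "j \<le> n"
    and dual: "\<And>u v. u \<in> {1..n} \<Longrightarrow> v \<in> {1..n} \<Longrightarrow> separated P u v \<Longrightarrow> i \<le> u \<Longrightarrow> u < j \<Longrightarrow> i \<le> v \<and> v < j"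
  shows "linked P i j"
proof (rule ccontr)
  assume nl: "\<not> linked P i j"
  note tr = linked_trans[OF P]
  have dom: "1 \<le> x \<and> x \<le> n \<and> 1 \<le> y \<and> y \<le> n" if "linked P x y" for x y
    using linked_in[OF P that] by auto
  have ii: "linked P i i" using linked_refl[OF P] ij by auto
  \<comment> \<open>The last element \<open>m\<close> of the block of \<open>i\<close> before
    \<open>j\<close>; as a dual point it lies between \<open>i\<close> and \<open>j\<close>, so
    \<open>dual\<close> applies to it.\<close>
  define S where "S = {m. linked P i m \<and> m < j}"
  have finS: "finite S" unfolding S_def by (rule finite_subset[of _ "{..<j}"]) auto
  define m where "m = Max S"
  have "i \<in> S" using ii ij unfolding S_def by simp
  then have mS: "m \<in> S" and im: "i \<le> m" using finS unfolding m_def by (auto intro: Max_in)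
  then have m: "linked P i m" "m < j" unfolding S_def by auto
  have maxm: "x \<le> m" if "linked P i x" "x < j" for x
    using Max_ge[OF finS, of x] that unfolding S_def m_def by simp
  have mi: "linked P m i" using m(1) by (rule linked_sym)
  show False
  proof (cases "\<exists>x. linked P i x \<and> j < x")
    case True
    \<comment> \<open>The next element of the block after \<open>m\<close>. The dual points
      \<open>m\<close> and \<open>M - 1\<close> are then separated from no block, yet
      \<open>M - 1\<close> is not below \<open>j\<close>.\<close>
    define M where "M = (LEAST x. linked P i x \<and> j < x)"
    have M: "linked P i M" "j < M" using LeastI_ex[OF True] unfolding M_def by auto
    have minM: "M \<le> x" if "linked P i x" "j < x" for x
      unfolding M_def using that by (intro Least_le) auto
    have mM: "linked P m M" using tr[OF mi M(1)] .
    have gap: "\<not> linked P i x" if "m < x" "x < M" for x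
      using maxm[of x] minM[of x] nl that by (metis leD linorder_neqE_nat)
    have "separated P m (M - 1)"
    proof (subst separated_less_iff)
      show "m < M - 1" using m M by simp
      show "\<forall>u v. linked P u v \<longrightarrow> m < u \<longrightarrow> u \<le> M - 1 \<longrightarrow> m < v \<and> v \<le> M - 1"
      proof (intro allI impI)
        fix u v assume uv: "linked P u v" and u: "m < u" "u \<le> M - 1"
        have "u < M" using u M by simp
        have nu: "\<not> linked P i u" using gap u(1) \<open>u < M\<close> .
        have nv: "\<not> linked P i v" using nu tr[OF _ linked_sym[OF uv]] by blast
        then have "v \<noteq> m" "v \<noteq> M" using m M by auto
        moreover have "\<not> v < m"
        proof
          assume "v < m"
          then have "linked P v m" using noncrossingD[OF nc linked_sym[OF uv] mM] u \<open>u < M\<close> by blast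
          then show False using nv tr[OF m(1) linked_sym] by blast
        qed
        moreover have "\<not> M < v"
        proof
          assume "M < v"
          then have "linked P m u" using noncrossingD[OF nc mM uv] u \<open>u < M\<close> by blast
          then show False using nu tr[OF m(1)] by blast
        qed
        ultimately show "m < v \<and> v \<le> M - 1" by linarith
      qed
    qed
    moreover have "m \<in> {1..n}" "M - 1 \<in> {1..n}" using dom[OF mM] m M by auto
    ultimately have "M - 1 < j" using dual[of m "M - 1"] m im by blast
    then show False using M by simp
  next
    case False
    then have le: "x \<le> m" if "linked P i x" for x
      using maxm[OF that] nl that by (metis linorder_neqE_nat)
    \<comment> \<open>Here \<open>m\<close> is the last element of its block, so its cyclic
      successor is the first element \<open>a\<close>, and the dual point preceding \<open>a\<close>
      lies outside the range that \<open>dual\<close> allows.\<close>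
    define a where "a = (LEAST x. linked P i x)"
    have a: "linked P i a" unfolding a_def using ii by (rule LeastI)
    have mina: "a \<le> x" if "linked P i x" for x
      unfolding a_def using that by (rule Least_le)
    have am: "linked P a m" using tr[OF linked_sym[OF a] m(1)] .
    have inside: "a < v \<and> v < m" if uv: "linked P u v" and u: "a \<le> u" "u \<le> m" and nu: "\<not> linked P i u" for u v
    proof -
      have nv: "\<not> linked P i v" using nu tr[OF _ linked_sym[OF uv]] by blast
      have u': "a < u" "u < m" using u nu a m by (auto simp: order.order_iff_strict)
      have "v \<noteq> a" "v \<noteq> m" using nv a m by auto
      moreover have "\<not> v < a"
      proof
        assume "v < a"
        then have "linked P v a" using noncrossingD[OF nc linked_sym[OF uv] am] u' by blast
        then show False using nv tr[OF a linked_sym] by blast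
      qed
      moreover have "\<not> m < v"
      proof
        assume "m < v"
        then have "linked P a u" using noncrossingD[OF nc am uv] u' by blast
        then show False using nu tr[OF a] by blast
      qed
      ultimately show ?thesis by simp
    qed
    have sat: "a \<le> v \<and> v \<le> m" if uv: "linked P u v" and u: "a \<le> u" "u \<le> m" for u v
      using inside[OF uv u] tr[OF _ uv] mina le by (cases "linked P i u") (auto simp: less_imp_le)
    have sym: "a \<le> u \<and> u \<le> m \<longleftrightarrow> a \<le> v \<and> v \<le> m" if "linked P u v" for u v
      using sat[OF that] sat[OF linked_sym[OF that]] by blast
    show False
    proof (cases "a = 1")
      case True
      \<comment> \<open>Cyclically, the dual point preceding \<open>1\<close> is
        \<open>n\<close>.\<close>
      have "separated P m n"
      proof (subst separated_less_iff)
        show "m < n" using m ij by simp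
        show "\<forall>u v. linked P u v \<longrightarrow> m < u \<longrightarrow> u \<le> n \<longrightarrow> m < v \<and> v \<le> n"
          using sym dom unfolding True by (meson not_le)
      qed
      then have "n < j" using dual[of m n] m dom[OF m(1)] im ij by auto
      then show False using ij by simp
    next
      case False
      then have a1: "1 < a" using dom[OF a] by simp
      have "separated P (a - 1) m"
      proof (subst separated_less_iff)
        show "a - 1 < m" using a1 mina[OF m(1)] by simp
        have "a - 1 < u \<longleftrightarrow> a \<le> u" for u using a1 by auto
        then show "\<forall>u v. linked P u v \<longrightarrow> a - 1 < u \<longrightarrow> u \<le> m \<longrightarrow> a - 1 < v \<and> v \<le> m"
          using sat by auto
      qed
      then have "separated P m (a - 1)" unfolding separated_def by blast
      moreover have "m \<in> {1..n}" "a - 1 \<in> {1..n}" using dom[OF m(1)] dom[OF a] a1 by auto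
      ultimately have "i \<le> a - 1" using dual[of m "a - 1"] m im by blast
      then show False using mina[OF ii] a1 by simp
    qed
  qed
qed

text \<open>For even points the condition is the definition of \<open>separated\<close>. For odd
  points, linked implies sealed because a chord of \<open>Q\<close> violating it would separate two
  points of a block of \<open>P\<close> (\<open>PQ\<close>); the converse is
  \<open>linked_if_dual_sealed\<close>.\<close>

lemma interleave_biNC:
  assumes P: "partition_on {1..n} P" and nc: "noncrossing P" and Q: "partition_on {1..n} Q"
    and LQ: "\<And>i j. i \<in> {1..n} \<Longrightarrow> j \<in> {1..n} \<Longrightarrow> linked Q i j \<longleftrightarrow> separated P i j"
  shows "interleave P Q \<in> biNC 1 (2 * n + 1)"
proof (rule biNCI)
  let ?M = "interleave P Q"
  have domP: "1 \<le> x \<and> x \<le> n \<and> 1 \<le> y \<and> y \<le> n" if "linked P x y" for x y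
    using linked_in[OF P that] by auto
  have domQ: "1 \<le> x \<and> x \<le> n \<and> 1 \<le> y \<and> y \<le> n" if "linked Q x y" for x y
    using linked_in[OF Q that] by auto
  note tr = linked_trans[OF P]
  show "partition_on {1..<2 * n + 1} ?M" by (rule partition_on_interleave[OF P Q])
  have cases: "(\<exists>i j. linked P (Suc i) (Suc j) \<and> x = 2 * i + 1 \<and> y = 2 * j + 1) \<or>
      (\<exists>i j. linked Q i j \<and> x = 2 * i \<and> y = 2 * j)" if xy: "linked ?M x y" for x y
  proof -
    have "\<exists>i' j'. linked P (Suc i') (Suc j') \<and> x = 2 * i' + 1 \<and> y = 2 * j' + 1"
      if "linked P i j" "x = 2 * i - 1" "y = 2 * j - 1" for i j
      using that domP[OF that(1)] by (intro exI[of _ "i - 1"] exI[of _ "j - 1"]) auto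
    then show ?thesis using xy unfolding linked_interleave by blast
  qed
  show "even (x + y)" if "linked ?M x y" for x y
    using cases[OF that] by auto
  have LQ': "linked Q i j \<longleftrightarrow> (\<forall>u v. linked P u v \<longrightarrow> i < u \<longrightarrow> u \<le> j \<longrightarrow> i < v \<and> v \<le> j)"
    if "1 \<le> i" "i < j" "j \<le> n" for i j
    using LQ[of i j] separated_less_iff[OF that(2)] that by simp
  have QP: "i < v \<and> v \<le> j" if "linked Q i j" "i < j" "linked P u v" "i < u" "u \<le> j" for i j u v
    using LQ'[of i j] domQ[OF that(1)] that by blast
  have PQ: "i \<le> v \<and> v < j" if "linked P i j" "linked Q u v" "i \<le> u" "u < j" for i j u v
  proof -
    have "i \<le> v"
    proof (rule ccontr)
      assume "\<not> i \<le> v"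
      then show False
        using QP[OF linked_sym[OF that(2)] _ that(1)] that(3,4) by auto
    qed
    moreover have "v < j"
    proof (rule ccontr)
      assume "\<not> v < j"
      then show False
        using QP[OF that(2) _ linked_sym[OF that(1)]] that(3,4) by auto
    qed
    ultimately show ?thesis by simp
  qed
  show "x < v \<and> v < y" if xy: "linked ?M x y" and uv: "linked ?M u v"
    and h: "odd (x + u)" "x < u" "u < y" for x y u v
  proof -
    consider i j k l where "linked P (Suc i) (Suc j)" "x = 2 * i + 1" "y = 2 * j + 1"
        "linked Q k l" "u = 2 * k" "v = 2 * l"
      | i j k l where "linked Q i j" "x = 2 * i" "y = 2 * j"
        "linked P (Suc k) (Suc l)" "u = 2 * k + 1" "v = 2 * l + 1"
      using cases[OF xy] cases[OF uv] h(1) by fastforce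
    then show ?thesis
    proof cases
      case 1
      then show ?thesis using PQ[OF 1(1,4)] h by auto
    next
      case 2
      then show ?thesis using QP[OF 2(1) _ 2(4)] h by auto
    qed
  qed
  fix x y assume x: "1 \<le> x" "x < y" "y < 2 * n + 1" "even (x + y)" and s: "sealed ?M x y"
  show "linked ?M x y"
  proof (cases "even x")
    case True
    then obtain i j where ij: "x = 2 * i" "y = 2 * j" using x(4) by (metis evenE even_add)
    have "i < v \<and> v \<le> j" if uv: "linked P u v" and u: "i < u" "u \<le> j" for u v
    proof -
      obtain k l where kl: "u = Suc k" "v = Suc l" using domP[OF uv] by (cases u; cases v) auto
      then have "linked ?M (2 * k + 1) (2 * l + 1)" using uv linked_interleave_odd[OF P] by simp
      moreover have "odd (x + (2 * k + 1))" "x < 2 * k + 1" "2 * k + 1 < y" using ij u kl by auto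
      ultimately have "x < 2 * l + 1 \<and> 2 * l + 1 < y" using s unfolding sealed_def by blast
      then show ?thesis using ij kl by auto
    qed
    then have "linked Q i j" using LQ'[of i j] ij x by auto
    then show ?thesis using linked_interleave_even[OF P] ij by simp
  next
    case False
    then have "odd y" using x(4) by presburger
    from False \<open>odd y\<close> obtain i j where ij: "x = 2 * i + 1" "y = 2 * j + 1" by (auto elim!: oddE)
    have "linked P (Suc i) (Suc j)"
    proof (rule linked_if_dual_sealed[OF P nc])
      show "1 \<le> Suc i" "Suc i < Suc j" "Suc j \<le> n" using x ij by auto
      fix u v assume u: "u \<in> {1..n}" "v \<in> {1..n}" "separated P u v" "Suc i \<le> u" "u < Suc j"
      then have "linked ?M (2 * u) (2 * v)" using LQ linked_interleave_even[OF P] by blast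
      moreover have "odd (x + 2 * u)" "x < 2 * u" "2 * u < y" using ij u by auto
      ultimately have "x < 2 * v \<and> 2 * v < y" using s unfolding sealed_def by blast
      then show "Suc i \<le> v \<and> v < Suc j" using ij by auto
    qed
    then show ?thesis using linked_interleave_odd[OF P] ij by simp
  qed
qed

lemma noncrossing_biNC: "M \<in> biNC a b \<Longrightarrow> noncrossing M"
  by (rule noncrossingI[OF biNC_partition biNC_noncrossing])

text \<open>The quotient is admissible since its interleaving with \<open>P\<close> lies in
  \<open>biNC\<close>. It is the greatest one since every admissible \<open>R\<close> links only
  separated points, and antisymmetry of refinement makes it unique.\<close>

lemma kreweras_eq:
  assumes P: "partition_on {1..n} P" and nc: "noncrossing P"
  shows "kreweras n P = {1..n} // kreweras_rel n P"
  unfolding kreweras_def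
proof (rule the_equality)
  let ?Q = "{1..n} // kreweras_rel n P"
  have Q: "partition_on {1..n} ?Q" using partition_on_quotient[OF equiv_kreweras_rel] .
  have LQ: "linked ?Q i j \<longleftrightarrow> separated P i j" if "i \<in> {1..n}" "j \<in> {1..n}" for i j
    using that by (subst linked_quotient[OF equiv_kreweras_rel]) (simp add: kreweras_rel_def)
  have ncQ: "noncrossing (interleave P ?Q)"
    by (rule noncrossing_biNC[OF interleave_biNC[OF P nc Q LQ]])
  have max: "refines {1..n} R ?Q" if R: "partition_on {1..n} R" and ncR: "noncrossing (interleave P R)" for R
    unfolding refines_def
  proof (intro conjI ballI)
    fix X assume X: "X \<in> R"
    then obtain x where x: "x \<in> X" using partition_onD3[OF R] by (metis equals0I)
    have "linked ?Q x y" if y: "y \<in> X" for y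
    proof -
      have l: "linked R x y" "linked R y x" using X x y by (auto simp: linked_def)
      have "separated P x y"
      proof (cases x y rule: linorder_cases)
        case less
        then show ?thesis using separated_if_noncrossing_interleave[OF P R ncR l(1)] by simp
      next
        case equal
        then show ?thesis by (simp add: separated_def)
      next
        case greater
        then have "separated P y x" using separated_if_noncrossing_interleave[OF P R ncR l(2)] by simp
        then show ?thesis unfolding separated_def by blast
      qed
      then show ?thesis using LQ linked_in[OF R l(1)] by blast
    qed
    then have "X \<subseteq> block_of ?Q x" by (auto simp: in_block_of_iff)
    moreover have "x \<in> {1..n}" using x X R by (auto simp: partition_on_def)
    ultimately show "\<exists>Y\<in>?Q. X \<subseteq> Y" using block_of_in[OF Q] by blast
  qed (use R Q in auto)
  show "partition_on {1..n} ?Q \<and> noncrossing (interleave P ?Q) \<and>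
      (\<forall>R. partition_on {1..n} R \<and> noncrossing (interleave P R) \<longrightarrow> refines {1..n} R ?Q)"
    using Q ncQ max by blast
  show "Q' = ?Q" if "partition_on {1..n} Q' \<and> noncrossing (interleave P Q') \<and>
      (\<forall>R. partition_on {1..n} R \<and> noncrossing (interleave P R) \<longrightarrow> refines {1..n} R Q')" for Q'
    using that Q ncQ max refines_asym by blast
qed

lemma partition_on_kreweras:
  assumes "partition_on {1..n} P" "noncrossing P"
  shows "partition_on {1..n} (kreweras n P)"
  unfolding kreweras_eq[OF assms] by (rule partition_on_quotient[OF equiv_kreweras_rel])

lemma linked_kreweras:
  assumes "partition_on {1..n} P" "noncrossing P" and "i \<in> {1..n}" "j \<in> {1..n}"
  shows "linked (kreweras n P) i j \<longleftrightarrow> separated P i j"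
  unfolding kreweras_eq[OF assms(1,2)] using assms(3,4)
  by (subst linked_quotient[OF equiv_kreweras_rel]) (simp add: kreweras_rel_def)

section \<open>The bijection between noncrossing partitions and \<open>biNC\<close>\<close>

definition ncp :: "nat \<Rightarrow> nat set set set" where
  "ncp n = {P. partition_on {1..n} P \<and> noncrossing P}"

definition both :: "nat \<Rightarrow> nat set set \<Rightarrow> nat set set" where
  "both n P = interleave P (kreweras n P)"

lemma biNC_both: "P \<in> ncp n \<Longrightarrow> both n P \<in> biNC 1 (2 * n + 1)"
  unfolding ncp_def both_def mem_Collect_eq
  using interleave_biNC[OF _ _ partition_on_kreweras linked_kreweras] by blast

lemma inj_on_both: "inj_on (both n) (ncp n)"
proof (rule inj_onI)
  fix P P' assume "P \<in> ncp n" "P' \<in> ncp n" and eq: "both n P = both n P'"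
  then have p: "partition_on {1..n} P" "partition_on {1..n} P'" by (auto simp: ncp_def)
  show "P = P'"
  proof (rule partition_eqI[OF p])
    fix x y
    have L: "linked P (Suc i) (Suc j) \<longleftrightarrow> linked P' (Suc i) (Suc j)" for i j
      using linked_interleave_odd[OF p(1), of _ i j] linked_interleave_odd[OF p(2), of _ i j] eq
      unfolding both_def by metis
    show "linked P x y \<longleftrightarrow> linked P' x y"
      using L linked_in[OF p(1), of x y] linked_in[OF p(2), of x y] by (cases x; cases y) auto
  qed
qed

text \<open>The preimage \<open>P\<close> is the trace of \<open>M\<close> on the odd points. Two
  even points are linked in \<open>M\<close> iff they are sealed, which says that they are separated
  by \<open>P\<close>; so the trace on the even points is the dual.\<close>

lemma surj_both:
  assumes M: "M \<in> biNC 1 (2 * n + 1)"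
  shows "\<exists>P\<in>ncp n. both n P = M"
proof -
  define r where "r = {(i, j). i \<in> {1..n} \<and> j \<in> {1..n} \<and> linked M (2 * i - 1) (2 * j - 1)}"
  define P where "P = {1..n} // r"
  note pM = biNC_partition[OF M]
  have "equiv {1..n} r"
  proof (rule equivI)
    have "linked M (2 * i - 1) (2 * i - 1)" if "i \<in> {1..n}" for i
      using that by (intro linked_refl[OF pM]) auto
    then show "refl_on {1..n} r" by (auto simp: refl_on_def r_def)
    show "sym r" using linked_sym by (auto simp: sym_def r_def)
    show "trans r" using linked_trans[OF pM] unfolding trans_def r_def by blast
    show "r \<subseteq> {1..n} \<times> {1..n}" by (auto simp: r_def)
  qed
  then have pP: "partition_on {1..n} P" and "linked P i j \<longleftrightarrow> (i, j) \<in> r" for i j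
    unfolding P_def by (auto intro: partition_on_quotient simp: linked_quotient)
  then have LP: "linked P i j \<longleftrightarrow> i \<in> {1..n} \<and> j \<in> {1..n} \<and> linked M (2 * i - 1) (2 * j - 1)" for i j
    by (simp add: r_def)
  have ncP: "noncrossing P"
  proof (rule noncrossingI[OF pP])
    fix i j k l assume "linked P i k" "linked P j l" "i < j" "j < k" "k < l"
    then show "linked P i j"
      unfolding LP using biNC_noncrossing[OF M, of "2 * i - 1" "2 * k - 1" "2 * j - 1" "2 * l - 1"] by auto
  qed
  have sep: "linked M (2 * i) (2 * j) \<longleftrightarrow> separated P i j" if ij: "i \<in> {1..n}" "j \<in> {1..n}" "i < j" for i j
  proof
    assume l: "linked M (2 * i) (2 * j)"
    show "separated P i j" unfolding separated_less_iff[OF ij(3)]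
    proof (intro allI impI)
      fix u v assume "linked P u v" "i < u" "u \<le> j"
      moreover from this have "odd (2 * i + (2 * u - 1))" by auto
      ultimately have "2 * i < 2 * v - 1 \<and> 2 * v - 1 < 2 * j"
        using biNC_nc[OF M l, of "2 * u - 1" "2 * v - 1"] unfolding LP by auto
      then show "i < v \<and> v \<le> j" by auto
    qed
  next
    assume s: "separated P i j"
    have "sealed M (2 * i) (2 * j)" unfolding sealed_def
    proof (intro allI impI)
      fix u v assume uv: "linked M u v" "odd (2 * i + u)" "2 * i < u" "u < 2 * j"
      then have "odd u" "odd v" using biNC_even[OF M uv(1)] by auto
      then obtain k l where kl: "u = 2 * k + 1" "v = 2 * l + 1" by (auto elim!: oddE)
      then have "linked P (Suc k) (Suc l)" unfolding LP using uv(1) biNC_bounds[OF M uv(1)] by auto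
      moreover have "i < Suc k" "Suc k \<le> j" using uv kl by auto
      ultimately have "i < Suc l \<and> Suc l \<le> j" using s unfolding separated_less_iff[OF ij(3)] by blast
      then show "2 * i < v \<and> v < 2 * j" using kl by auto
    qed
    then show "linked M (2 * i) (2 * j)" using biNC_linkedI[OF M] ij by auto
  qed
  have LK: "linked (kreweras n P) i j \<longleftrightarrow> linked M (2 * i) (2 * j)" if ij: "i \<in> {1..n}" "j \<in> {1..n}" for i j
  proof -
    have "linked M (2 * i) (2 * j) \<longleftrightarrow> separated P i j"
    proof (cases i j rule: linorder_cases)
      case less
      then show ?thesis using sep ij by blast
    next
      case equal
      then show ?thesis using linked_refl[OF pM, of "2 * i"] ij by (auto simp: separated_def)
    next
      case greater
      then have "linked M (2 * j) (2 * i) \<longleftrightarrow> separated P j i" using sep ij by blast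
      moreover have "separated P j i \<longleftrightarrow> separated P i j" unfolding separated_def by blast
      ultimately show ?thesis using linked_sym by blast
    qed
    then show ?thesis using linked_kreweras[OF pP ncP ij] by simp
  qed
  have pK: "partition_on {1..n} (kreweras n P)" by (rule partition_on_kreweras[OF pP ncP])
  have "both n P = M"
  proof (rule partition_eqI[OF _ pM])
    show "partition_on {1..<2 * n + 1} (both n P)"
      unfolding both_def by (rule partition_on_interleave[OF pP pK])
    fix x y
    show "linked (both n P) x y \<longleftrightarrow> linked M x y"
    proof
      assume "linked (both n P) x y"
      then show "linked M x y"
        unfolding both_def linked_interleave using LP LK linked_in[OF pK] by blast
    next
      assume l: "linked M x y"
      then have b: "1 \<le> x" "x < 2 * n + 1" "1 \<le> y" "y < 2 * n + 1" and "even (x + y)"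
        using biNC_bounds[OF M] biNC_even[OF M] by blast+
      show "linked (both n P) x y"
      proof (cases "even x")
        case True
        then have "even y" using \<open>even (x + y)\<close> by presburger
        from True \<open>even y\<close> obtain i j where ij: "x = 2 * i" "y = 2 * j" by (auto elim!: evenE)
        then have "linked (kreweras n P) i j" using LK[of i j] b l by auto
        then show ?thesis unfolding both_def linked_interleave using ij by blast
      next
        case False
        then have "odd y" using \<open>even (x + y)\<close> by presburger
        from False \<open>odd y\<close> obtain i j where ij: "x = 2 * i + 1" "y = 2 * j + 1" by (auto elim!: oddE)
        then have "linked P (Suc i) (Suc j)" unfolding LP using b l by auto
        moreover have "x = 2 * Suc i - 1" "y = 2 * Suc j - 1" using ij by auto
        ultimately show ?thesis unfolding both_def linked_interleave by blast
      qed
    qed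
  qed
  then show ?thesis using pP ncP by (auto simp: ncp_def)
qed

lemma bij_betw_both: "bij_betw (both n) (ncp n) (biNC 1 (2 * n + 1))"
proof (rule bij_betw_imageI[OF inj_on_both], intro equalityI subsetI)
  show "M \<in> both n ` ncp n" if "M \<in> biNC 1 (2 * n + 1)" for M
    using surj_both[OF that] by auto
qed (use biNC_both in auto)

section \<open>Generating functions\<close>

unbundle fps_syntax

text \<open>The minimum serves only to read off the colour, which all elements of a block share
  (\<open>biNC_even_Min\<close>): \<open>f\<close> weighs even blocks and \<open>g\<close> odd
  ones.\<close>

definition block_weight :: "(nat \<Rightarrow> 'a::comm_ring_1) \<Rightarrow> (nat \<Rightarrow> 'a) \<Rightarrow> nat set \<Rightarrow> 'a" where
  "block_weight f g B = (if even (Min B) then f else g) (card B)"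

definition biNC_weight :: "(nat \<Rightarrow> 'a::comm_ring_1) \<Rightarrow> (nat \<Rightarrow> 'a) \<Rightarrow> nat \<Rightarrow> nat \<Rightarrow> 'a" where
  "biNC_weight f g a b = (\<Sum>P\<in>biNC a b. \<Prod>B\<in>P. block_weight f g B)"

text \<open>The block of the first point carries its own weight \<open>h\<close>, which is shifted by one when the last
  point of an interval of odd length is deleted.\<close>
definition rooted_weight ::
  "(nat \<Rightarrow> 'a::comm_ring_1) \<Rightarrow> (nat \<Rightarrow> 'a) \<Rightarrow> (nat \<Rightarrow> 'a) \<Rightarrow> nat \<Rightarrow> nat \<Rightarrow> 'a" where
  "rooted_weight h f g a b =
     (\<Sum>P\<in>biNC a b. h (card (block_of P a)) * (\<Prod>B\<in>P - {block_of P a}. block_weight f g B))"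

lemma finite_biNC_elem: "P \<in> biNC a b \<Longrightarrow> finite P"
  using finite_elements[OF _ biNC_partition] by blast

lemma finite_biNC_block: "P \<in> biNC a b \<Longrightarrow> B \<in> P \<Longrightarrow> finite B"
  using biNC_partition[of P a b] by (auto simp: partition_on_def intro!: finite_subset[of B "{a..<b}"])

lemma biNC_even_Min:
  assumes P: "P \<in> biNC a b" and B: "B \<in> P" and x: "x \<in> B"
  shows "even (Min B) \<longleftrightarrow> even x"
proof -
  have "Min B \<in> B" using finite_biNC_block[OF P B] x by (intro Min_in) auto
  then have "linked P (Min B) x" using B x by (auto simp: linked_def)
  then show ?thesis using biNC_even[OF P] by fastforce
qed

lemma rooted_weight_self:
  assumes "a < b"
  shows "rooted_weight (if even a then f else g) f g a b = biNC_weight f g a b"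
  unfolding rooted_weight_def biNC_weight_def
proof (rule sum.cong[OF refl])
  fix P assume P: "P \<in> biNC a b"
  have a: "block_of P a \<in> P" "a \<in> block_of P a"
    using block_of_in[OF biNC_partition[OF P]] in_block_of_self[OF biNC_partition[OF P]] assms by auto
  have "(if even a then f else g) (card (block_of P a)) = block_weight f g (block_of P a)"
    using biNC_even_Min[OF P a] by (simp add: block_weight_def)
  then show "(if even a then f else g) (card (block_of P a)) * (\<Prod>B\<in>P - {block_of P a}. block_weight f g B)
      = (\<Prod>B\<in>P. block_weight f g B)"
    using prod.remove[OF finite_biNC_elem[OF P] a(1), of "block_weight f g"] by simp
qed

text \<open>The first block lies entirely in the left part, so \<open>h\<close> stays with the left
  factor and the right factor has ordinary weights.\<close>

lemma rooted_weight_split: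
  assumes len: "even (b - a)" "a < b"
  shows "rooted_weight h f g a b =
    (\<Sum>c\<in>{c \<in> {a..<b}. odd (c - a)}. rooted_weight h f g a c * biNC_weight f g c b)"
proof -
  let ?F = "\<lambda>P. h (card (block_of P a)) * (\<Prod>B\<in>P - {block_of P a}. block_weight f g B)"
  let ?S = "SIGMA c:{c \<in> {a..<b}. odd (c - a)}. biNC a c \<times> biNC c b"
  have *: "?F (P \<union> Q) = ?F P * (\<Prod>B\<in>Q. block_weight f g B)"
    if P: "P \<in> biNC a c" and Q: "Q \<in> biNC c b" and c: "odd (c - a)" "c < b" for c P Q
  proof -
    have "odd (b - c)" using c len by presburger
    then have A: "block_of (P \<union> Q) a = block_of P a" using Max_block_Un[OF P Q c(1)] by simp
    have "a < c" using c by (auto intro: ccontr)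
    have P': "B \<subseteq> {a..<c}" "B \<noteq> {}" if "B \<in> P" for B
      using biNC_partition[OF P] that by (auto simp: partition_on_def)
    have Q': "B \<subseteq> {c..<b}" if "B \<in> Q" for B
      using biNC_partition[OF Q] that by (auto simp: partition_on_def)
    have disj: "P \<inter> Q = {}"
    proof (rule ccontr)
      assume "P \<inter> Q \<noteq> {}"
      then obtain B where "B \<in> P" "B \<in> Q" by blast
      moreover from this obtain x where "x \<in> B" using P'(2) by blast
      ultimately show False using P'(1)[of B] Q'[of B] by fastforce
    qed
    have "block_of P a \<in> P" using block_of_in[OF biNC_partition[OF P]] \<open>a < c\<close> by simp
    then have "P \<union> Q - {block_of P a} = (P - {block_of P a}) \<union> Q" using disj by blast
    moreover have "(P - {block_of P a}) \<inter> Q = {}" using disj by blast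
    ultimately have "(\<Prod>B\<in>P \<union> Q - {block_of P a}. block_weight f g B) =
        (\<Prod>B\<in>P - {block_of P a}. block_weight f g B) * (\<Prod>B\<in>Q. block_weight f g B)"
      using finite_biNC_elem[OF P] finite_biNC_elem[OF Q] by (simp add: prod.union_disjoint)
    then show ?thesis unfolding A by (simp add: mult.assoc)
  qed
  have "rooted_weight h f g a b = (\<Sum>(c, P, Q)\<in>?S. ?F (P \<union> Q))"
    unfolding rooted_weight_def sum.reindex_bij_betw[OF bij_betw_split[OF len], symmetric]
    by (simp add: case_prod_beta)
  also have "\<dots> = (\<Sum>(c, P, Q)\<in>?S. ?F P * (\<Prod>B\<in>Q. block_weight f g B))"
    by (intro sum.cong) (auto simp: *)
  also have "\<dots> = (\<Sum>c\<in>{c \<in> {a..<b}. odd (c - a)}. \<Sum>(P, Q)\<in>biNC a c \<times> biNC c b.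
      ?F P * (\<Prod>B\<in>Q. block_weight f g B))"
    by (subst sum.Sigma) (auto simp: finite_biNC)
  also have "\<dots> = (\<Sum>c\<in>{c \<in> {a..<b}. odd (c - a)}. rooted_weight h f g a c * biNC_weight f g c b)"
    unfolding rooted_weight_def biNC_weight_def sum_product
    by (intro sum.cong refl) (simp add: sum.cartesian_product)
  finally show ?thesis .
qed

lemma rooted_weight_add_point:
  assumes len: "even (b - a)" "a < b"
  shows "rooted_weight h f g a (Suc b) = rooted_weight (\<lambda>k. h (Suc k)) f g a b"
  unfolding rooted_weight_def sum.reindex_bij_betw[OF bij_betw_add_point[OF len], symmetric]
proof (rule sum.cong[OF refl])
  fix P assume P: "P \<in> biNC a b"
  note pP = biNC_partition[OF P]
  let ?A = "block_of P a"
  have aA: "a \<in> {a..<b}" using len by simp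
  have A: "?A \<in> P" "a \<in> ?A" using block_of_in[OF pP aA] in_block_of_self[OF pP aA] .
  have nb: "b \<notin> B" if "B \<in> P" for B using pP that by (auto simp: partition_on_def)
  have "block_of (add_point a b P) a = insert b ?A"
    unfolding block_of_def linked_add_point[OF pP aA] using len linked_refl[OF pP aA] by auto
  moreover have "add_point a b P - {insert b ?A} = P - {?A}"
    unfolding add_point_def using nb by auto
  moreover have "card (insert b ?A) = Suc (card ?A)"
    using finite_biNC_block[OF P A(1)] nb[OF A(1)] by simp
  ultimately show "h (card (block_of (add_point a b P) a)) *
      (\<Prod>B\<in>add_point a b P - {block_of (add_point a b P) a}. block_weight f g B) =
      h (Suc (card ?A)) * (\<Prod>B\<in>P - {?A}. block_weight f g B)" by simp
qed

lemma rooted_weight_singleton: "rooted_weight h f g a (Suc a) = h 1"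
proof -
  have "block_of {{a}} a = {a}" by (auto simp: block_of_def linked_def)
  then show ?thesis by (simp add: rooted_weight_def biNC_singleton)
qed

text \<open>Translation by one exchanges the colours, hence the two weights.\<close>

lemma biNC_weight_Suc: "biNC_weight f g (Suc a) (Suc b) = biNC_weight g f a b"
proof -
  have "inj_on ((`) ((`) Suc)) (biNC a b)" by (rule inj_on_subset[OF inj_image_Suc]) simp
  then have "biNC_weight f g (Suc a) (Suc b) =
      (\<Sum>P\<in>biNC a b. \<Prod>B\<in>(`) Suc ` P. block_weight f g B)"
    unfolding biNC_weight_def biNC_Suc by (simp add: sum.reindex)
  also have "\<dots> = (\<Sum>P\<in>biNC a b. \<Prod>B\<in>P. block_weight g f B)"
  proof (rule sum.cong[OF refl])
    fix P assume P: "P \<in> biNC a b"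
    have "inj_on ((`) Suc) P" by (intro inj_on_image inj_on_subset[OF inj_Suc]) auto
    then have "(\<Prod>B\<in>(`) Suc ` P. block_weight f g B) = (\<Prod>B\<in>P. block_weight f g (Suc ` B))"
      by (simp add: prod.reindex)
    also have "\<dots> = (\<Prod>B\<in>P. block_weight g f B)"
    proof (rule prod.cong[OF refl])
      fix B assume B: "B \<in> P"
      have "B \<noteq> {}" using partition_onD3[OF biNC_partition[OF P]] B by blast
      then have "Min (Suc ` B) = Suc (Min B)"
        using finite_biNC_block[OF P B] mono_Min_commute[of Suc B] by (simp add: mono_Suc)
      then show "block_weight f g (Suc ` B) = block_weight g f B"
        by (simp add: block_weight_def card_image)
    qed
    finally show "(\<Prod>B\<in>(`) Suc ` P. block_weight f g B) = (\<Prod>B\<in>P. block_weight g f B)" .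
  qed
  finally show ?thesis by (simp add: biNC_weight_def)
qed

lemma biNC_weight_shift:
  "biNC_weight f g (a + k) (b + k) = (if even k then biNC_weight f g a b else biNC_weight g f a b)"
  by (induction k arbitrary: f g) (auto simp: biNC_weight_Suc)

text \<open>The exponent \<open>m\<close> stands for \<open>2 * m + 1\<close> points. Both end
  points are even, so the first argument weighs the colour of the end points.\<close>

definition odd_gf :: "(nat \<Rightarrow> 'a::comm_ring_1) \<Rightarrow> (nat \<Rightarrow> 'a) \<Rightarrow> 'a fps" where
  "odd_gf f g = Abs_fps (\<lambda>m. biNC_weight f g 0 (2 * m + 1))"

lemma biNC_weight_eq_odd_gf:
  assumes "b = a + 2 * m + 1"
  shows "biNC_weight f g a b = (if even a then odd_gf f g else odd_gf g f) $ m"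
  using biNC_weight_shift[of f g 0 a "2 * m + 1"] assms by (simp add: odd_gf_def add.commute)

text \<open>The right part starts at an odd point, whence the exchanged arguments of
  \<open>odd_gf\<close>.\<close>

lemma rooted_weight_even:
  "rooted_weight h f g 0 (2 * Suc m) =
    (\<Sum>i\<le>m. rooted_weight h f g 0 (2 * i + 1) * odd_gf g f $ (m - i))"
proof -
  have "rooted_weight h f g 0 (2 * Suc m) =
      (\<Sum>c\<in>{c \<in> {0..<2 * Suc m}. odd (c - 0)}. rooted_weight h f g 0 c * biNC_weight f g c (2 * Suc m))"
    by (rule rooted_weight_split) auto
  also have "{c \<in> {0..<2 * Suc m}. odd (c - 0)} = (\<lambda>i. 2 * i + 1) ` {..m}"
    by (auto simp: image_iff elim!: oddE)
  also have "(\<Sum>c\<in>(\<lambda>i. 2 * i + 1) ` {..m}. rooted_weight h f g 0 c * biNC_weight f g c (2 * Suc m)) =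
      (\<Sum>i\<le>m. rooted_weight h f g 0 (2 * i + 1) * biNC_weight f g (2 * i + 1) (2 * Suc m))"
    by (subst sum.reindex) (auto simp: inj_on_def)
  also have "\<dots> = (\<Sum>i\<le>m. rooted_weight h f g 0 (2 * i + 1) * odd_gf g f $ (m - i))"
  proof (rule sum.cong[OF refl])
    fix i assume "i \<in> {..m}"
    then have "2 * Suc m = (2 * i + 1) + 2 * (m - i) + 1" by auto
    from biNC_weight_eq_odd_gf[OF this, of f g]
    show "rooted_weight h f g 0 (2 * i + 1) * biNC_weight f g (2 * i + 1) (2 * Suc m) =
        rooted_weight h f g 0 (2 * i + 1) * odd_gf g f $ (m - i)" by simp
  qed
  finally show ?thesis .
qed

text \<open>The laws of \<open>oo\<close> for products in the library need an integral domain.\<close>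
lemma fps_compose_X_mult_Suc:
  fixes U :: "'a::comm_ring_1 fps"
  shows "(Abs_fps c oo (fps_X * U)) $ Suc k = (\<Sum>j\<le>k. (Abs_fps (\<lambda>i. c (Suc i)) oo (fps_X * U)) $ j * U $ (k - j))"
proof -
  let ?Y = "fps_X * U"
  have Y0: "?Y $ 0 = 0" by simp
  have "(Abs_fps c oo ?Y) $ Suc k = (\<Sum>i\<le>k. c (Suc i) * (?Y ^ Suc i) $ Suc k)"
    unfolding fps_compose_nth atMost_atLeast0[symmetric] by (subst sum.atMost_Suc_shift) simp
  also have "\<dots> = (\<Sum>i\<le>k. c (Suc i) * (\<Sum>j\<le>k. (?Y ^ i) $ j * U $ (k - j)))"
  proof (rule sum.cong[OF refl])
    fix i
    have "?Y ^ Suc i = fps_X * (?Y ^ i * U)" by (simp add: algebra_simps)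
    then have "(?Y ^ Suc i) $ Suc k = (?Y ^ i * U) $ k" by (simp only: fps_X_mult_nth) simp
    then show "c (Suc i) * (?Y ^ Suc i) $ Suc k = c (Suc i) * (\<Sum>j\<le>k. (?Y ^ i) $ j * U $ (k - j))"
      by (simp only: fps_mult_nth atMost_atLeast0)
  qed
  also have "\<dots> = (\<Sum>j\<le>k. (\<Sum>i\<le>k. c (Suc i) * (?Y ^ i) $ j) * U $ (k - j))"
    unfolding sum_distrib_left sum_distrib_right by (subst sum.swap) (simp add: mult.assoc)
  also have "\<dots> = (\<Sum>j\<le>k. (Abs_fps (\<lambda>i. c (Suc i)) oo ?Y) $ j * U $ (k - j))"
  proof (rule sum.cong[OF refl])
    fix j assume j: "j \<in> {..k}"
    \<comment> \<open>The powers with \<open>i > j\<close> have no coefficient at \<open>j\<close>,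
      because \<open>?Y\<close> has no constant term.\<close>
    have "(\<Sum>i\<le>k. c (Suc i) * (?Y ^ i) $ j) = (\<Sum>i\<le>j. c (Suc i) * (?Y ^ i) $ j)"
      using startsby_zero_power_prefix[OF Y0] j by (intro sum.mono_neutral_right) auto
    then show "(\<Sum>i\<le>k. c (Suc i) * (?Y ^ i) $ j) * U $ (k - j) =
        (Abs_fps (\<lambda>i. c (Suc i)) oo ?Y) $ j * U $ (k - j)"
      by (simp add: fps_compose_nth atMost_atLeast0)
  qed
  finally show ?thesis .
qed

text \<open>Deleting the last point and cutting the remaining even interval yields the recursion of
  \<open>fps_compose_X_mult_Suc\<close>. Each round shifts \<open>h\<close> by one, so the induction
  is over all \<open>h\<close>.\<close>

lemma rooted_weight_odd:
  "rooted_weight h f g 0 (2 * m + 1) = (Abs_fps (\<lambda>i. h (Suc i)) oo (fps_X * odd_gf g f)) $ m"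
proof (induction m arbitrary: h rule: less_induct)
  case (less m)
  show ?case
  proof (cases m)
    case 0
    then show ?thesis using rooted_weight_singleton[of h f g 0] by simp
  next
    case (Suc k)
    have "rooted_weight h f g 0 (2 * m + 1) = rooted_weight (\<lambda>i. h (Suc i)) f g 0 (2 * Suc k)"
      using rooted_weight_add_point[of "2 * Suc k" 0 h f g] Suc by simp
    also have "\<dots> = (\<Sum>j\<le>k. (Abs_fps (\<lambda>i. h (Suc (Suc i))) oo (fps_X * odd_gf g f)) $ j * odd_gf g f $ (k - j))"
      unfolding rooted_weight_even using less Suc by (intro sum.cong refl) simp
    also have "\<dots> = (Abs_fps (\<lambda>i. h (Suc i)) oo (fps_X * odd_gf g f)) $ Suc k"
      by (rule fps_compose_X_mult_Suc[symmetric])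
    finally show ?thesis using Suc by simp
  qed
qed

lemma odd_gf_eq: "odd_gf f g = Abs_fps (\<lambda>i. f (Suc i)) oo (fps_X * odd_gf g f)"
proof (rule fps_ext)
  fix m
  have "odd_gf f g $ m = rooted_weight f f g 0 (2 * m + 1)"
    using rooted_weight_self[of 0 "2 * m + 1" f g] by (simp add: odd_gf_def)
  then show "odd_gf f g $ m = (Abs_fps (\<lambda>i. f (Suc i)) oo (fps_X * odd_gf g f)) $ m"
    unfolding rooted_weight_odd .
qed

lemma biNC_weight_even: "biNC_weight f g 0 (2 * Suc m) = (odd_gf f g * odd_gf g f) $ m"
proof -
  have "biNC_weight f g 0 (2 * Suc m) = rooted_weight f f g 0 (2 * Suc m)"
    using rooted_weight_self[of 0 "2 * Suc m" f g] by simp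
  also have "\<dots> = (\<Sum>i\<le>m. odd_gf f g $ i * odd_gf g f $ (m - i))"
    unfolding rooted_weight_even using rooted_weight_self[of 0 _ f g] by (simp add: odd_gf_def)
  finally show ?thesis by (simp add: fps_mult_nth atMost_atLeast0)
qed

section \<open>Partitions with a prescribed singleton block, and the number of blocks\<close>

text \<open>The singleton is selected by a root weight \<open>h\<close> supported at size
  \<open>1\<close>. For a cut \<open>c \<noteq> Suc a\<close> the block of \<open>a\<close> also
  contains \<open>c - 1\<close>, so only the cut right after \<open>a\<close> survives.\<close>

lemma sum_biNC_first_singleton:
  assumes len: "even (b - a)" "a < b"
  shows "(\<Sum>P\<in>{P \<in> biNC a b. {a} \<in> P}. \<Prod>B\<in>P. block_weight f g B) =
    block_weight f g {a} * biNC_weight f g (Suc a) b"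
proof -
  define h where "h k = (if k = 1 then block_weight f g {a} else 0)" for k :: nat
  have card1: "card (block_of P a) = 1 \<longleftrightarrow> block_of P a = {a}" if P: "P \<in> biNC a c" "a < c" for P c
    using in_block_of_self[OF biNC_partition[OF P(1)], of a] P(2) by (auto simp: card_1_singleton_iff)
  have "(\<Sum>P\<in>{P \<in> biNC a b. {a} \<in> P}. \<Prod>B\<in>P. block_weight f g B) = rooted_weight h f g a b"
    unfolding rooted_weight_def
  proof (rule sum.mono_neutral_cong_left)
    show "finite (biNC a b)" by (rule finite_biNC)
    have in_iff: "{a} \<in> P \<longleftrightarrow> block_of P a = {a}" if P: "P \<in> biNC a b" for P
      using partition_eq_block[OF biNC_partition[OF P], of "{a}" a] block_of_in[OF biNC_partition[OF P], of a] len
      by auto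
    show "\<forall>P\<in>biNC a b - {P \<in> biNC a b. {a} \<in> P}.
        h (card (block_of P a)) * (\<Prod>B\<in>P - {block_of P a}. block_weight f g B) = 0"
      using in_iff card1 len by (auto simp: h_def)
    fix P assume "P \<in> {P \<in> biNC a b. {a} \<in> P}"
    then have P: "P \<in> biNC a b" "{a} \<in> P" "block_of P a = {a}" using in_iff by auto
    show "(\<Prod>B\<in>P. block_weight f g B) =
        h (card (block_of P a)) * (\<Prod>B\<in>P - {block_of P a}. block_weight f g B)"
      using prod.remove[OF finite_biNC_elem[OF P(1)] P(2), of "block_weight f g"] by (simp add: P(3) h_def)
  qed auto
  also have "\<dots> = (\<Sum>c\<in>{c \<in> {a..<b}. odd (c - a)}. rooted_weight h f g a c * biNC_weight f g c b)"
    by (rule rooted_weight_split[OF len])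
  also have "\<dots> = (\<Sum>c\<in>{Suc a}. rooted_weight h f g a c * biNC_weight f g c b)"
  proof (rule sum.mono_neutral_right)
    have "Suc a < b" using len by presburger
    then show "{Suc a} \<subseteq> {c \<in> {a..<b}. odd (c - a)}" by auto
    show "\<forall>c\<in>{c \<in> {a..<b}. odd (c - a)} - {Suc a}. rooted_weight h f g a c * biNC_weight f g c b = 0"
    proof
      fix c assume c: "c \<in> {c \<in> {a..<b}. odd (c - a)} - {Suc a}"
      then have "a < c" "c \<noteq> Suc a" "odd (c - a)" by (auto intro: ccontr)
      have "h (card (block_of P a)) = 0" if P: "P \<in> biNC a c" for P
      proof -
        have "linked P a (c - 1)" using biNC_first_last[OF P] \<open>a < c\<close> \<open>odd (c - a)\<close> by blast
        then have "c - 1 \<in> block_of P a" by (simp add: in_block_of_iff)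
        moreover have "c - 1 \<noteq> a" using \<open>c \<noteq> Suc a\<close> \<open>a < c\<close> by simp
        ultimately show ?thesis using card1[OF P \<open>a < c\<close>] by (auto simp: h_def)
      qed
      then have "rooted_weight h f g a c = 0" unfolding rooted_weight_def by (intro sum.neutral) simp
      then show "rooted_weight h f g a c * biNC_weight f g c b = 0" by simp
    qed
  qed auto
  finally show ?thesis by (simp add: rooted_weight_singleton h_def)
qed

text \<open>Rotation preserves the size of each block, and its colour since \<open>a\<close> and
  \<open>b\<close> have the same parity.\<close>

lemma prod_rename:
  assumes P: "P \<in> biNC a b" and len: "even (b - a)" "a < b"
  shows "(\<Prod>B\<in>rename a b P. block_weight f g B) = (\<Prod>B\<in>P. block_weight f g B)"
proof -
  let ?r = "\<lambda>x. if x = a then b else x"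
  have sub: "B \<subseteq> {a..<b}" if "B \<in> P" for B
    using biNC_partition[OF P] that by (auto simp: partition_on_def)
  have inj: "inj_on ?r {a..<b}" by (auto simp: inj_on_def)
  then have "inj_on ((`) ?r) P"
    using sub by (intro inj_on_image) (blast intro: inj_on_subset)
  then have "(\<Prod>B\<in>rename a b P. block_weight f g B) = (\<Prod>B\<in>P. block_weight f g (?r ` B))"
    unfolding rename_def by (simp only: prod.reindex comp_def)
  also have "\<dots> = (\<Prod>B\<in>P. block_weight f g B)"
  proof (rule prod.cong[OF refl])
    fix B assume B: "B \<in> P"
    then obtain x where x: "x \<in> B" using partition_onD3[OF biNC_partition[OF P]] by (metis equals0I)
    have "?r ` B \<in> rename a b P" "?r x \<in> ?r ` B" using B x unfolding rename_def by blast+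
    then have "even (Min (?r ` B)) \<longleftrightarrow> even (?r x)"
      by (rule biNC_even_Min[OF biNC_rename[OF P len]])
    also have "\<dots> \<longleftrightarrow> even x" using len by auto
    also have "\<dots> \<longleftrightarrow> even (Min B)" using biNC_even_Min[OF P B x] by simp
    finally have "even (Min (?r ` B)) \<longleftrightarrow> even (Min B)" .
    moreover have "card (?r ` B) = card B"
      using inj_on_subset[OF inj sub[OF B]] by (rule card_image)
    ultimately show "block_weight f g (?r ` B) = block_weight f g B" by (simp add: block_weight_def)
  qed
  finally show ?thesis .
qed

lemma rename_singleton_iff:
  assumes "x \<noteq> a" "x < b"
  shows "{x} \<in> rename a b P \<longleftrightarrow> {x} \<in> P"
proof -
  let ?r = "\<lambda>y. if y = a then b else y"
  have "?r ` B = {x} \<longleftrightarrow> B = {x}" for B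
  proof
    assume eq: "?r ` B = {x}"
    have "y = x" if "y \<in> B" for y
    proof -
      have "?r y = x" using eq that by blast
      then show ?thesis using assms(2) by (auto split: if_splits)
    qed
    moreover have "B \<noteq> {}" using eq by blast
    ultimately show "B = {x}" by blast
  qed (use assms(1) in simp)
  then have "{x} \<in> (`) ?r ` P \<longleftrightarrow> (\<exists>B\<in>P. B = {x})" unfolding image_iff by metis
  then show ?thesis unfolding rename_def by simp
qed

text \<open>Rotation makes \<open>Suc a\<close> the first point, which reduces the claim to
  \<open>sum_biNC_first_singleton\<close>.\<close>

lemma sum_biNC_second_singleton:
  assumes len: "even (b - a)" "a < b"
  shows "(\<Sum>P\<in>{P \<in> biNC a b. {Suc a} \<in> P}. \<Prod>B\<in>P. block_weight f g B) =
    block_weight f g {Suc a} * biNC_weight f g (Suc (Suc a)) (Suc b)"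
proof -
  have "Suc a < b" using len by presburger
  then have bij: "bij_betw (rename a b) {P \<in> biNC a b. {Suc a} \<in> P} {P \<in> biNC (Suc a) (Suc b). {Suc a} \<in> P}"
    by (intro bij_betw_Collect[OF bij_betw_rename[OF len]] rename_singleton_iff) auto
  have "(\<Sum>P\<in>{P \<in> biNC a b. {Suc a} \<in> P}. \<Prod>B\<in>P. block_weight f g B) =
      (\<Sum>P\<in>{P \<in> biNC a b. {Suc a} \<in> P}. \<Prod>B\<in>rename a b P. block_weight f g B)"
    by (intro sum.cong refl) (simp add: prod_rename[OF _ len])
  also have "\<dots> = (\<Sum>P\<in>{P \<in> biNC (Suc a) (Suc b). {Suc a} \<in> P}. \<Prod>B\<in>P. block_weight f g B)"
    by (rule sum.reindex_bij_betw[OF bij])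
  also have "\<dots> = block_weight f g {Suc a} * biNC_weight f g (Suc (Suc a)) (Suc b)"
    using len by (intro sum_biNC_first_singleton) auto
  finally show ?thesis .
qed

text \<open>For length \<open>2 * n\<close> these are the \<open>n + 1\<close> vertices of a plane
  tree with \<open>n\<close> edges. In the induction, cutting an even interval adds the block counts
  of its parts, and deleting the last point of a longer odd interval keeps the count.\<close>

lemma card_biNC_elem:
  "P \<in> biNC a b \<Longrightarrow> a < b \<Longrightarrow> card P = Suc ((b - a) div 2)"
proof (induction "b - a" arbitrary: a b P rule: less_induct)
  case less
  note P = \<open>P \<in> biNC a b\<close>
  show ?case
  proof (cases "even (b - a)")
    case True
    define c where "c = Suc (Max (block_of P a))"
    define P1 where "P1 = {B \<in> P. B \<subseteq> {a..<c}}"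
    define P2 where "P2 = {B \<in> P. B \<subseteq> {c..<b}}"
    note s = biNC_split[OF P True less.prems(2), folded c_def, folded P1_def P2_def]
    have "P1 \<inter> P2 = {}"
    proof (rule ccontr)
      assume "P1 \<inter> P2 \<noteq> {}"
      then obtain B where "B \<in> P" "B \<subseteq> {a..<c}" "B \<subseteq> {c..<b}" unfolding P1_def P2_def by blast
      moreover from this obtain x where "x \<in> B" using partition_onD3[OF biNC_partition[OF P]] by (metis equals0I)
      ultimately show False by fastforce
    qed
    then have "card P = card P1 + card P2"
      using card_Un_disjoint[OF finite_biNC_elem[OF s(5)] finite_biNC_elem[OF s(6)]] s(7) by simp
    also have "\<dots> = Suc ((c - a) div 2) + Suc ((b - c) div 2)"
      using less.hyps[OF _ s(5)] less.hyps[OF _ s(6)] s by auto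
    also have "\<dots> = Suc ((b - a) div 2)"
    proof -
      obtain p q where pq: "c - a = 2 * p + 1" "b - c = 2 * q + 1"
        using oddE[OF s(1)] oddE[OF s(4)] by metis
      then have "b - a = 2 * (p + q + 1)" using s(2,3) by simp
      then show ?thesis using pq by simp
    qed
    finally show ?thesis .
  next
    case False
    show ?thesis
    proof (cases "b = Suc a")
      case True
      then show ?thesis using P biNC_singleton by auto
    next
      case not1: False
      define b' where "b' = b - 1"
      have b': "b = Suc b'" "even (b' - a)" "a < b'" using False not1 less.prems(2) unfolding b'_def by auto
      then obtain Q where Q: "Q \<in> biNC a b'" "P = add_point a b' Q"
        using bij_betw_imp_surj_on[OF bij_betw_add_point[OF b'(2,3)]] P by (metis imageE)
      have A: "block_of Q a \<in> Q" using block_of_in[OF biNC_partition[OF Q(1)]] b' by simp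
      have "insert b' (block_of Q a) \<notin> Q" using biNC_partition[OF Q(1)] by (auto simp: partition_on_def)
      then have "card P = card Q"
        unfolding Q(2) add_point_def
        using finite_biNC_elem[OF Q(1)] card_Suc_Diff1[OF finite_biNC_elem[OF Q(1)] A]
        by (simp del: card_Diff_singleton card_Diff_insert)
      also have "\<dots> = Suc ((b' - a) div 2)" using less.hyps[OF _ Q(1)] b' by auto
      also have "\<dots> = Suc ((b - a) div 2)"
      proof -
        obtain p where "b' - a = 2 * p" using evenE[OF b'(2)] by metis
        then show ?thesis using b'(1,3) by (simp add: Suc_diff_le)
      qed
      finally show ?thesis .
    qed
  qed
qed

section \<open>Congruence conditions on the block sizes\<close>

definition pair_weight ::
  "(nat \<Rightarrow> 'a::comm_ring_1) \<Rightarrow> (nat \<Rightarrow> 'a) \<Rightarrow> nat \<Rightarrow> nat set set \<Rightarrow> 'a" where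
  "pair_weight f g n P = (\<Prod>B\<in>P. f (card B)) * (\<Prod>C\<in>kreweras n P. g (card C))"

lemma ncpD:
  assumes "P \<in> ncp n"
  shows "partition_on {1..n} P" and "partition_on {1..n} (kreweras n P)"
    and "finite P" and "finite (kreweras n P)"
proof -
  show *: "partition_on {1..n} P" "partition_on {1..n} (kreweras n P)"
    using assms partition_on_kreweras unfolding ncp_def by blast+
  show "finite P" "finite (kreweras n P)"
    using finite_elements[OF _ *(1)] finite_elements[OF _ *(2)] by auto
qed

lemma finite_ncp: "finite (ncp n)"
  by (rule finite_subset[OF _ finitely_many_partition_on[of "{1..n}"]]) (auto simp: ncp_def)

lemma both_disjoint:
  assumes "P \<in> ncp n"
  shows "(`) (\<lambda>i. 2 * i - 1) ` P \<inter> (`) (\<lambda>i. 2 * i) ` kreweras n P = {}"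
proof (rule ccontr)
  assume "(`) (\<lambda>i. 2 * i - 1) ` P \<inter> (`) (\<lambda>i. 2 * i) ` kreweras n P \<noteq> {}"
  then obtain B C where B: "B \<in> P" "C \<in> kreweras n P" "(\<lambda>i. 2 * i - 1) ` B = (\<lambda>i. 2 * i) ` C" by auto
  then obtain x where x: "x \<in> B" using partition_onD3[OF ncpD(1)[OF assms]] by (metis equals0I)
  then have "x \<ge> 1" using partition_onD1[OF ncpD(1)[OF assms]] B(1) by auto
  moreover obtain y where "2 * x - 1 = 2 * y" using x B(3) by blast
  ultimately show False by presburger
qed

lemma inj_on_image_odd:
  assumes "P \<in> ncp n"
  shows "inj_on ((`) (\<lambda>i. 2 * i - 1)) P" and "\<And>B. B \<in> P \<Longrightarrow> inj_on (\<lambda>i. 2 * i - 1) B"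
proof -
  have *: "\<Union>P = {1..n}" using partition_onD1[OF ncpD(1)[OF assms]] by simp
  have inj: "inj_on (\<lambda>i. 2 * i - 1) {1..n}" by (auto simp: inj_on_def)
  then show "inj_on ((`) (\<lambda>i. 2 * i - 1)) P" by (intro inj_on_image) (simp only: *)
  show "inj_on (\<lambda>i. 2 * i - 1) B" if "B \<in> P" for B
    using inj_on_subset[OF inj] that * by blast
qed

lemma inj_on_image_even: "inj_on ((`) (\<lambda>i::nat. 2 * i)) A"
  by (intro inj_on_image) (auto simp: inj_on_def)

text \<open>The points of \<open>P\<close> become odd and those of the dual even, so
  \<open>f\<close> and \<open>g\<close> enter \<open>block_weight\<close> in reverse order.\<close>

lemma prod_both:
  assumes P: "P \<in> ncp n"
  shows "(\<Prod>B\<in>both n P. block_weight g f B) = pair_weight f g n P"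
proof -
  have M: "both n P \<in> biNC 1 (2 * n + 1)" by (rule biNC_both[OF P])
  let ?o = "\<lambda>i::nat. 2 * i - 1" and ?e = "\<lambda>i::nat. 2 * i"
  have wo: "block_weight g f (?o ` B) = f (card B)" if B: "B \<in> P" for B
  proof -
    obtain x where x: "x \<in> B" using B partition_onD3[OF ncpD(1)[OF P]] by (metis equals0I)
    then have "x \<ge> 1" using partition_onD1[OF ncpD(1)[OF P]] B by auto
    have "?o ` B \<in> both n P" "?o x \<in> ?o ` B" using B x unfolding both_def interleave_def by blast+
    then have "even (Min (?o ` B)) \<longleftrightarrow> even (?o x)" by (rule biNC_even_Min[OF M])
    then have "odd (Min (?o ` B))" using \<open>x \<ge> 1\<close> by presburger
    then show ?thesis using card_image[OF inj_on_image_odd(2)[OF P B]] by (simp add: block_weight_def)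
  qed
  have we: "block_weight g f (?e ` C) = g (card C)" if C: "C \<in> kreweras n P" for C
  proof -
    obtain x where x: "x \<in> C" using C partition_onD3[OF ncpD(2)[OF P]] by (metis equals0I)
    have "?e ` C \<in> both n P" "?e x \<in> ?e ` C" using C x unfolding both_def interleave_def by blast+
    then have "even (Min (?e ` C)) \<longleftrightarrow> even (?e x)" by (rule biNC_even_Min[OF M])
    then show ?thesis by (simp add: block_weight_def card_image inj_on_def)
  qed
  have "(\<Prod>B\<in>both n P. block_weight g f B) =
      (\<Prod>B\<in>(`) ?o ` P. block_weight g f B) * (\<Prod>B\<in>(`) ?e ` kreweras n P. block_weight g f B)"
    unfolding both_def interleave_def
    by (rule prod.union_disjoint) (use ncpD[OF P] both_disjoint[OF P] in auto)
  also have "\<dots> = pair_weight f g n P"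
    unfolding pair_weight_def prod.reindex[OF inj_on_image_odd(1)[OF P]] prod.reindex[OF inj_on_image_even] comp_def
    by (simp only: wo we cong: prod.cong)
  finally show ?thesis .
qed

lemma card_kreweras:
  assumes P: "P \<in> ncp n" and "n \<ge> 1"
  shows "card P + card (kreweras n P) = n + 1"
proof -
  have "card (both n P) = card P + card (kreweras n P)"
    unfolding both_def interleave_def
    using card_Un_disjoint[OF _ _ both_disjoint[OF P]] ncpD[OF P]
      card_image[OF inj_on_image_odd(1)[OF P]] card_image[OF inj_on_image_even, of "kreweras n P"]
    by simp
  then show ?thesis using card_biNC_elem[OF biNC_both[OF P]] assms(2) by simp
qed

lemma sum_pair_weight:
  "(\<Sum>P\<in>ncp (Suc k). pair_weight f g (Suc k) P) = (odd_gf g f * odd_gf f g) $ k"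
proof -
  have "(\<Sum>P\<in>ncp (Suc k). pair_weight f g (Suc k) P) = biNC_weight g f 1 (2 * Suc k + 1)"
    unfolding biNC_weight_def sum.reindex_bij_betw[OF bij_betw_both, symmetric]
    by (intro sum.cong refl) (simp only: prod_both)
  then show ?thesis
    using biNC_weight_shift[of g f 0 1 "2 * Suc k"] biNC_weight_even[of f g k] by (simp add: mult.commute)
qed

text \<open>Without the first point, whose block weighs \<open>f 1 = 1\<close>, the remaining
  interval starts at the even point \<open>2\<close>, that is, at the dual point \<open>1'\<close>.
  Its leading weight is therefore the dual weight \<open>g\<close>.\<close>

lemma sum_pair_weight_first:
  assumes "f 1 = 1"
  shows "(\<Sum>P\<in>{P \<in> ncp (Suc k). {1} \<in> P}. pair_weight f g (Suc k) P) = odd_gf g f $ k"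
proof -
  let ?n = "Suc k"
  have iff: "{1} \<in> both ?n P \<longleftrightarrow> {1} \<in> P" if P: "P \<in> ncp ?n" for P
  proof
    assume "{1} \<in> P"
    then have "(\<lambda>i. 2 * i - 1) ` {1} \<in> both ?n P" unfolding both_def interleave_def by blast
    then show "{1} \<in> both ?n P" by simp
  next
    assume "{1} \<in> both ?n P"
    moreover have "{1} \<noteq> (\<lambda>i::nat. 2 * i) ` C" for C
    proof
      assume "{1} = (\<lambda>i::nat. 2 * i) ` C"
      then obtain i :: nat where "1 = 2 * i" by blast
      then show False by presburger
    qed
    ultimately obtain B where B: "B \<in> P" "{1} = (\<lambda>i. 2 * i - 1) ` B"
      unfolding both_def interleave_def by blast
    have "x = 1" if "x \<in> B" for x
    proof -
      have "2 * x - 1 = 1" using B(2) that by blast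
      then show ?thesis by simp
    qed
    moreover have "B \<noteq> {}" using B(2) by blast
    ultimately have "B = {1}" by blast
    then show "{1} \<in> P" using B(1) by simp
  qed
  have bij: "bij_betw (both ?n) {P \<in> ncp ?n. {1} \<in> P} {M \<in> biNC 1 (2 * ?n + 1). {1} \<in> M}"
    by (intro bij_betw_Collect[OF bij_betw_both] iff)
  have "(\<Sum>P\<in>{P \<in> ncp ?n. {1} \<in> P}. pair_weight f g ?n P) =
      (\<Sum>M\<in>{M \<in> biNC 1 (2 * ?n + 1). {1} \<in> M}. \<Prod>B\<in>M. block_weight g f B)"
    unfolding sum.reindex_bij_betw[OF bij, symmetric] by (intro sum.cong refl) (simp add: prod_both)
  also have "\<dots> = block_weight g f {1} * biNC_weight g f (Suc 1) (2 * ?n + 1)"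
    by (rule sum_biNC_first_singleton) auto
  also have "\<dots> = odd_gf g f $ k"
    using biNC_weight_eq_odd_gf[of "2 * ?n + 1" 2 k g f] assms by (simp add: block_weight_def numeral_2_eq_2)
  finally show ?thesis .
qed

text \<open>The dual point \<open>1'\<close> is the second point of the interval. Once it has been
  rotated to the front and removed, the rest starts at the odd point \<open>3\<close>, so the
  leading weight is \<open>f\<close>.\<close>

lemma sum_pair_weight_dual_first:
  assumes "g 1 = 1"
  shows "(\<Sum>P\<in>{P \<in> ncp (Suc k). {1} \<in> kreweras (Suc k) P}. pair_weight f g (Suc k) P) = odd_gf f g $ k"
proof -
  let ?n = "Suc k"
  have iff: "{Suc 1} \<in> both ?n P \<longleftrightarrow> {1} \<in> kreweras ?n P" for P
  proof
    assume "{1} \<in> kreweras ?n P"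
    then have "(\<lambda>i. 2 * i) ` {1} \<in> both ?n P" unfolding both_def interleave_def by blast
    then show "{Suc 1} \<in> both ?n P" by (simp add: numeral_2_eq_2)
  next
    assume "{Suc 1} \<in> both ?n P"
    moreover have "{Suc 1} \<noteq> (\<lambda>i::nat. 2 * i - 1) ` B" for B
    proof
      assume "{Suc 1} = (\<lambda>i::nat. 2 * i - 1) ` B"
      then obtain i :: nat where "Suc 1 = 2 * i - 1" by blast
      then show False by presburger
    qed
    ultimately obtain C where C: "C \<in> kreweras ?n P" "{Suc 1} = (\<lambda>i. 2 * i) ` C"
      unfolding both_def interleave_def by blast
    have "x = 1" if "x \<in> C" for x
    proof -
      have "2 * x = Suc 1" using C(2) that by blast
      then show ?thesis by simp
    qed
    moreover have "C \<noteq> {}" using C(2) by blast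
    ultimately have "C = {1}" by blast
    then show "{1} \<in> kreweras ?n P" using C(1) by simp
  qed
  have bij: "bij_betw (both ?n) {P \<in> ncp ?n. {1} \<in> kreweras ?n P} {M \<in> biNC 1 (2 * ?n + 1). {Suc 1} \<in> M}"
    by (intro bij_betw_Collect[OF bij_betw_both] iff)
  have "(\<Sum>P\<in>{P \<in> ncp ?n. {1} \<in> kreweras ?n P}. pair_weight f g ?n P) =
      (\<Sum>M\<in>{M \<in> biNC 1 (2 * ?n + 1). {Suc 1} \<in> M}. \<Prod>B\<in>M. block_weight g f B)"
    unfolding sum.reindex_bij_betw[OF bij, symmetric] by (intro sum.cong refl) (simp add: prod_both)
  also have "\<dots> = block_weight g f {Suc 1} * biNC_weight g f (Suc (Suc 1)) (Suc (2 * ?n + 1))"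
    by (rule sum_biNC_second_singleton) auto
  also have "\<dots> = odd_gf f g $ k"
    using biNC_weight_eq_odd_gf[of "2 * ?n + 2" 3 k g f] assms by (simp add: block_weight_def numeral_3_eq_3)
  finally show ?thesis .
qed

section \<open>Uniqueness of the solution of the system\<close>

lemma fps_X_mult_power_nth:
  fixes U :: "'a::comm_ring_1 fps"
  shows "((fps_X * U) ^ i) $ m = (if m < i then 0 else (U ^ i) $ (m - i))"
  by (simp only: power_mult_distrib fps_X_power_mult_nth)

lemma fps_power_agree:
  fixes F G :: "'a::comm_ring_1 fps"
  assumes "\<And>i. i < N \<Longrightarrow> F $ i = G $ i"
  shows "m < N \<Longrightarrow> (F ^ j) $ m = (G ^ j) $ m"
proof (induction j arbitrary: m)
  case (Suc j)
  then show ?case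
    unfolding power_Suc fps_mult_nth using assms by (intro sum.cong refl) auto
qed simp

text \<open>The term of index \<open>i > 0\<close> involves a power of the inner series only up to
  exponent \<open>m - i < m\<close>, and the term of index \<open>0\<close> does not involve
  it.\<close>

lemma fps_compose_X_mult_agree:
  fixes F G :: "'a::comm_ring_1 fps"
  assumes "\<And>i. i < m \<Longrightarrow> F $ i = G $ i"
  shows "(A oo (fps_X * F)) $ m = (A oo (fps_X * G)) $ m"
  unfolding fps_compose_nth
proof (rule sum.cong[OF refl])
  fix i assume "i \<in> {0..m}"
  then show "A $ i * ((fps_X * F) ^ i) $ m = A $ i * ((fps_X * G) ^ i) $ m"
    using fps_power_agree[of m F G "m - i" i, OF assms] by (cases "i = 0") (auto simp: fps_X_mult_power_nth)
qed

text \<open>Coefficient \<open>m\<close> of either right-hand side depends only on lower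
  coefficients of the other series, so strong induction on \<open>m\<close> treats both series at
  once.\<close>

lemma composition_system_unique:
  fixes F G F' G' :: "'a::comm_ring_1 fps"
  assumes "F = A oo (fps_X * (fps_const s * G ^ d))" "G = A' oo (fps_X * (fps_const t * F ^ d))"
    and "F' = A oo (fps_X * (fps_const s * G' ^ d))" "G' = A' oo (fps_X * (fps_const t * F' ^ d))"
  shows "F = F' \<and> G = G'"
proof -
  have "F $ m = F' $ m \<and> G $ m = G' $ m" for m
  proof (induction m rule: less_induct)
    case (less m)
    have "(fps_const s * G ^ d) $ i = (fps_const s * G' ^ d) $ i"
      and "(fps_const t * F ^ d) $ i = (fps_const t * F' ^ d) $ i" if "i < m" for i
      using fps_power_agree[of m G G' i d] fps_power_agree[of m F F' i d] less that by auto
    from fps_compose_X_mult_agree[of m, OF this(1)] fps_compose_X_mult_agree[of m, OF this(2)]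
    show ?case using assms by metis
  qed
  then show ?thesis by (simp add: fps_eq_iff)
qed

section \<open>Series in powers of \<open>x^d\<close>\<close>

text \<open>On \<open>sparse\<close> series this substitutes \<open>x\<close> for
  \<open>x^d\<close>.\<close>

definition decimate :: "nat \<Rightarrow> 'a::comm_ring_1 fps \<Rightarrow> 'a fps" where
  "decimate d F = Abs_fps (\<lambda>k. F $ (d * k))"

definition sparse :: "nat \<Rightarrow> 'a::comm_ring_1 fps \<Rightarrow> bool" where
  "sparse d F \<longleftrightarrow> (\<forall>m. \<not> d dvd m \<longrightarrow> F $ m = 0)"

lemma sum_multiples:
  fixes h :: "nat \<Rightarrow> 'a::comm_monoid_add"
  assumes "d \<ge> 1" and "\<And>j. \<not> d dvd j \<Longrightarrow> h j = 0"
  shows "(\<Sum>j=0..d * k. h j) = (\<Sum>i=0..k. h (d * i))"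
proof -
  have "(\<Sum>i=0..k. h (d * i)) = sum h ((*) d ` {0..k})"
    using assms(1) by (subst sum.reindex) (auto simp: inj_on_def)
  also have "\<dots> = (\<Sum>j=0..d * k. h j)"
  proof (rule sum.mono_neutral_left)
    show "\<forall>j\<in>{0..d * k} - (*) d ` {0..k}. h j = 0"
    proof
      fix j assume j: "j \<in> {0..d * k} - (*) d ` {0..k}"
      have "\<not> d dvd j"
      proof
        assume "d dvd j"
        then obtain i where "j = d * i" by blast
        then show False using j assms(1) by auto
      qed
      then show "h j = 0" by (rule assms(2))
    qed
  qed (use assms(1) in auto)
  finally show ?thesis by simp
qed

text \<open>In the coefficient of exponent \<open>d * k\<close>, only multiples of \<open>d\<close>
  contribute from \<open>F\<close>, and the complementary exponent is then a multiple of
  \<open>d\<close> as well.\<close>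

lemma decimate_mult:
  assumes "d \<ge> 1" "sparse d F"
  shows "decimate d (F * G) = decimate d F * decimate d G"
proof (rule fps_ext)
  fix k
  have "(F * G) $ (d * k) = (\<Sum>i=0..k. F $ (d * i) * G $ (d * k - d * i))"
    unfolding fps_mult_nth using assms by (intro sum_multiples) (auto simp: sparse_def)
  then show "decimate d (F * G) $ k = (decimate d F * decimate d G) $ k"
    by (simp add: decimate_def fps_mult_nth diff_mult_distrib2)
qed

lemma decimate_power:
  assumes "d \<ge> 1" "sparse d F"
  shows "decimate d (F ^ j) = decimate d F ^ j"
proof (induction j)
  case 0
  show ?case using assms(1) by (simp add: decimate_def fps_eq_iff)
qed (simp add: decimate_mult[OF assms])

lemma sparse_power_below:
  fixes G :: "'a::comm_ring_1 fps"
  assumes "\<And>i. i < N \<Longrightarrow> \<not> d dvd i \<Longrightarrow> G $ i = 0"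
  shows "m < N \<Longrightarrow> \<not> d dvd m \<Longrightarrow> (G ^ j) $ m = 0"
proof (induction j arbitrary: m)
  case (Suc j)
  have "G $ i * (G ^ j) $ (m - i) = 0" if "i \<in> {0..m}" for i
  proof (cases "d dvd i")
    case True
    then have "\<not> d dvd (m - i)" using Suc.prems(2) that dvd_diffD[of d m i] by auto
    then show ?thesis using Suc by auto
  qed (use assms[of i] Suc.prems that in auto)
  then show ?case unfolding power_Suc fps_mult_nth by (intro sum.neutral) blast
qed (metis dvd_0_right fps_one_nth power_0)

text \<open>In the coefficient of an exponent \<open>m\<close> not divisible by \<open>d\<close>, a
  term of index \<open>j > 0\<close> vanishes through the outer series unless \<open>d\<close>
  divides \<open>j\<close>. In that case \<open>m - j < m\<close> is not divisible by
  \<open>d\<close> either, and the induction hypothesis applies to the power of the inner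
  series.\<close>

lemma sparse_system:
  fixes F G :: "'a::comm_ring_1 fps"
  assumes "F = A oo (fps_X * G)" "G = A' oo (fps_X * F)" and "sparse d A" "sparse d A'"
  shows "sparse d F" and "sparse d G"
proof -
  have step: "(A oo (fps_X * G)) $ m = 0"
    if A: "sparse d A" and G: "\<And>i. i < m \<Longrightarrow> \<not> d dvd i \<Longrightarrow> G $ i = 0" and m: "\<not> d dvd m"
    for A G :: "'a fps" and m
    unfolding fps_compose_nth
  proof (rule sum.neutral, rule ballI)
    fix j assume j: "j \<in> {0..m}"
    show "A $ j * ((fps_X * G) ^ j) $ m = 0"
    proof (cases "d dvd j \<and> j \<noteq> 0")
      case True
      then have "\<not> d dvd (m - j)" "m - j < m" using m j dvd_diffD[of d m j] by auto
      then show ?thesis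
        using sparse_power_below[of m d G "m - j" j, OF G] j by (simp add: fps_X_mult_power_nth)
    next
      case False
      moreover have "m \<noteq> 0" using m by (metis dvd_0_right)
      ultimately show ?thesis using A by (auto simp: sparse_def)
    qed
  qed
  have "\<not> d dvd m \<longrightarrow> F $ m = 0 \<and> G $ m = 0" for m
  proof (induction m rule: less_induct)
    case (less m)
    show ?case
      using step[OF assms(3), of m G] step[OF assms(4), of m F] less assms(1,2) by metis
  qed
  then show "sparse d F" "sparse d G" unfolding sparse_def by blast+
qed

text \<open>Applied to block sizes \<open>k \<ge> 1\<close> only; the value at \<open>0\<close> is junk.\<close>
definition inflate :: "nat \<Rightarrow> (nat \<Rightarrow> 'a::comm_ring_1) \<Rightarrow> 'a \<Rightarrow> nat \<Rightarrow> 'a" where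
  "inflate d c s k = (if d dvd (k - 1) then c ((k - 1) div d) * s ^ ((k - 1) div d) else 0)"

text \<open>Only the indices \<open>j = d * i\<close> contribute. The power
  \<open>G ^ (d * i) = (G ^ d) ^ i\<close> explains the exponent \<open>d\<close> on the right, and
  the factor \<open>s ^ i\<close> hidden in \<open>inflate\<close> moves into the inner
  series.\<close>

lemma decimate_compose:
  fixes G :: "'a::comm_ring_1 fps"
  assumes d: "d \<ge> 1" and G: "sparse d G"
  shows "decimate d (Abs_fps (\<lambda>i. inflate d c s (Suc i)) oo (fps_X * G)) =
    Abs_fps c oo (fps_X * (fps_const s * decimate d G ^ d))"
proof (rule fps_ext)
  fix k
  have "(Abs_fps (\<lambda>i. inflate d c s (Suc i)) oo (fps_X * G)) $ (d * k) =
      (\<Sum>j=0..d * k. inflate d c s (Suc j) * ((fps_X * G) ^ j) $ (d * k))"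
    by (simp add: fps_compose_nth)
  also have "\<dots> = (\<Sum>i=0..k. inflate d c s (Suc (d * i)) * ((fps_X * G) ^ (d * i)) $ (d * k))"
    by (rule sum_multiples[OF d]) (simp add: inflate_def)
  also have "\<dots> = (\<Sum>i=0..k. c i * ((fps_X * (fps_const s * decimate d G ^ d)) ^ i) $ k)"
  proof (rule sum.cong[OF refl])
    fix i assume i: "i \<in> {0..k}"
    have "((fps_X * G) ^ (d * i)) $ (d * k) = (G ^ (d * i)) $ (d * (k - i))"
      using i by (simp add: fps_X_mult_power_nth diff_mult_distrib2)
    also have "\<dots> = (decimate d G ^ (d * i)) $ (k - i)"
      unfolding decimate_power[OF d G, symmetric] by (simp add: decimate_def)
    finally have "((fps_X * G) ^ (d * i)) $ (d * k) = (decimate d G ^ (d * i)) $ (k - i)" .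
    moreover have "inflate d c s (Suc (d * i)) = c i * s ^ i" using d by (simp add: inflate_def)
    moreover have "((fps_X * (fps_const s * decimate d G ^ d)) ^ i) $ k = s ^ i * (decimate d G ^ (d * i)) $ (k - i)"
    proof -
      have "(fps_const s * decimate d G ^ d) ^ i = fps_const (s ^ i) * decimate d G ^ (d * i)"
        by (simp add: power_mult_distrib power_mult fps_const_power)
      then show ?thesis using i by (simp add: fps_X_mult_power_nth)
    qed
    ultimately show "inflate d c s (Suc (d * i)) * ((fps_X * G) ^ (d * i)) $ (d * k) =
        c i * ((fps_X * (fps_const s * decimate d G ^ d)) ^ i) $ k" by (simp add: mult.assoc)
  qed
  finally show "decimate d (Abs_fps (\<lambda>i. inflate d c s (Suc i)) oo (fps_X * G)) $ k =
      (Abs_fps c oo (fps_X * (fps_const s * decimate d G ^ d))) $ k"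
    by (simp add: decimate_def fps_compose_nth)
qed

section \<open>Expressing \<open>wt\<close> by inflated block weights\<close>

lemma card_block_pos:
  assumes "partition_on A P" "finite A" "B \<in> P"
  shows "card B > 0"
  using assms partition_onD1[OF assms(1)] partition_onD3[OF assms(1)]
  by (metis Sup_upper card_gt_0_iff finite_subset)

lemma NC_iff:
  "P \<in> NC d n \<longleftrightarrow> P \<in> ncp n \<and> (\<forall>B\<in>P. d dvd (card B - 1)) \<and> (\<forall>C\<in>kreweras n P. d dvd (card C - 1))"
proof -
  have *: "[card B = 1] (mod d) \<longleftrightarrow> d dvd (card B - 1)" if "partition_on {1..n} Q" "B \<in> Q" for Q B
  proof -
    have "card B \<ge> 1" using card_block_pos[OF that(1) _ that(2)] by simp
    then show ?thesis by (simp add: cong_altdef_nat)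
  qed
  show ?thesis
    using * ncpD(1,2)[of P n] unfolding NC_def ncp_def by blast
qed

text \<open>The block sizes add up to \<open>n\<close>, so the numbers \<open>card B - 1\<close> add
  up to \<open>n - card Q\<close>; this makes the total exponent of \<open>s\<close> a function of
  the number of blocks.\<close>

lemma prod_inflate:
  assumes d: "d \<ge> 1" and Q: "partition_on {1..n} Q" and div: "\<forall>B\<in>Q. d dvd (card B - 1)"
  shows "(\<Prod>B\<in>Q. inflate d c s (card B)) = (\<Prod>B\<in>Q. c ((card B - 1) div d)) * s ^ ((n - card Q) div d)"
proof -
  have "card B = (card B - 1) + 1" if "B \<in> Q" for B
    using card_block_pos[OF Q _ that] by simp
  then have "(\<Sum>B\<in>Q. card B) = (\<Sum>B\<in>Q. (card B - 1) + 1)" by (intro sum.cong refl)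
  moreover have "(\<Sum>B\<in>Q. card B) = n"
    using product_partition[OF Q card_ge_0_finite[OF card_block_pos[OF Q]]] by simp
  ultimately have "(\<Sum>B\<in>Q. card B - 1) = n - card Q" by (simp only: sum.distrib) simp
  moreover have "(\<Sum>B\<in>Q. card B - 1) = d * (\<Sum>B\<in>Q. (card B - 1) div d)"
    unfolding sum_distrib_left using div by (intro sum.cong refl) simp
  ultimately have "(n - card Q) div d = (\<Sum>B\<in>Q. (card B - 1) div d)" using d by simp
  then show ?thesis
    using div by (simp add: inflate_def power_sum prod.distrib)
qed

text \<open>By \<open>card_kreweras\<close>, \<open>n - card P\<close> is the number of dual blocks
  minus one, and vice versa. Hence \<open>t\<close> is attached to the blocks of \<open>P\<close>
  and \<open>s\<close> to those of the dual.\<close>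

lemma pair_weight_inflate:
  assumes d: "d \<ge> 1" and P: "P \<in> ncp n" and n: "n \<ge> 1"
  shows "pair_weight (inflate d a t) (inflate d a' s) n P = (if P \<in> NC d n then wt d a a' s t n P else 0)"
proof (cases "P \<in> NC d n")
  case True
  then have div: "\<forall>B\<in>P. d dvd (card B - 1)" "\<forall>C\<in>kreweras n P. d dvd (card C - 1)"
    unfolding NC_iff by blast+
  have "n - card P = card (kreweras n P) - 1" "n - card (kreweras n P) = card P - 1"
    using card_kreweras[OF P n] by auto
  then show ?thesis
    unfolding pair_weight_def prod_inflate[OF d ncpD(1)[OF P] div(1)] prod_inflate[OF d ncpD(2)[OF P] div(2)]
    using True by (simp add: wt_def mult_ac)
next
  case False
  then consider B where "B \<in> P" "\<not> d dvd (card B - 1)" | C where "C \<in> kreweras n P" "\<not> d dvd (card C - 1)"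
    using P unfolding NC_iff by blast
  then have "(\<Prod>B\<in>P. inflate d a t (card B)) = 0 \<or> (\<Prod>C\<in>kreweras n P. inflate d a' s (card C)) = 0"
  proof cases
    case 1
    then have "inflate d a t (card B) = 0" by (simp add: inflate_def)
    then show ?thesis using prod_zero[OF ncpD(3)[OF P], of "\<lambda>B. inflate d a t (card B)"] 1(1) by blast
  next
    case 2
    then have "inflate d a' s (card C) = 0" by (simp add: inflate_def)
    then show ?thesis using prod_zero[OF ncpD(4)[OF P], of "\<lambda>C. inflate d a' s (card C)"] 2(1) by blast
  qed
  then show ?thesis using False by (auto simp: pair_weight_def)
qed

text \<open>The predicate \<open>R\<close> lets one statement serve the sums for
  \<open>B_fps\<close>, \<open>C_fps\<close> and \<open>Cstar_fps\<close>.\<close>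

lemma sum_wt:
  assumes "d \<ge> 1"
  shows "(\<Sum>P\<in>{P \<in> NC d (Suc m). R P}. wt d a a' s t (Suc m) P) =
    (\<Sum>P\<in>{P \<in> ncp (Suc m). R P}. pair_weight (inflate d a t) (inflate d a' s) (Suc m) P)"
proof (rule sum.mono_neutral_cong_left)
  show "{P \<in> NC d (Suc m). R P} \<subseteq> {P \<in> ncp (Suc m). R P}" by (auto simp: NC_iff)
qed (auto simp: pair_weight_inflate[OF assms] NC_iff finite_ncp)

theorem theorem4p1:
  fixes d :: nat and a a' :: "nat \<Rightarrow> 'a::comm_ring_1" and s t :: 'a
  assumes "d \<ge> 1" and "a 0 = 1" and "a' 0 = 1"
  shows "C_fps d a a' s t =
           Abs_fps a' oo (fps_X * fps_const s * Cstar_fps d a a' s t ^ d) \<and>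
         Cstar_fps d a a' s t =
           Abs_fps a oo (fps_X * fps_const t * C_fps d a a' s t ^ d) \<and>
         B_fps d a a' s t = C_fps d a a' s t * Cstar_fps d a a' s t \<and>
         (\<forall>F G :: 'a fps.
           F = Abs_fps a' oo (fps_X * fps_const s * G ^ d) \<and>
           G = Abs_fps a oo (fps_X * fps_const t * F ^ d) \<longrightarrow>
           F = C_fps d a a' s t \<and> G = Cstar_fps d a a' s t)"
proof -
  define f where "f = inflate d a t"
  define g where "g = inflate d a' s"
  have one: "f 1 = 1" "g 1 = 1" using assms by (auto simp: f_def g_def inflate_def)
  \<comment> \<open>The dual weight \<open>g\<close> comes first here, which is why the equation for
    \<open>C_fps\<close> has \<open>a'\<close> and \<open>s\<close> in it.\<close>
  have C: "C_fps d a a' s t = decimate d (odd_gf g f)"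
    unfolding C_fps_def decimate_def Suc_eq_plus1[symmetric] sum_wt[OF assms(1)]
    unfolding f_def[symmetric] g_def[symmetric] sum_pair_weight_first[of f, OF one(1)] ..
  have Cs: "Cstar_fps d a a' s t = decimate d (odd_gf f g)"
    unfolding Cstar_fps_def decimate_def Suc_eq_plus1[symmetric] sum_wt[OF assms(1)]
    unfolding f_def[symmetric] g_def[symmetric] sum_pair_weight_dual_first[of g, OF one(2)] ..
  have "B_fps d a a' s t = decimate d (odd_gf g f * odd_gf f g)"
    using sum_wt[OF assms(1), where R = "\<lambda>_. True" and a = a and a' = a' and s = s and t = t]
    unfolding B_fps_def decimate_def Suc_eq_plus1[symmetric]
    by (simp add: f_def[symmetric] g_def[symmetric] sum_pair_weight)
  moreover have "sparse d (Abs_fps (\<lambda>i. f (Suc i)))" "sparse d (Abs_fps (\<lambda>i. g (Suc i)))"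
    by (auto simp: sparse_def f_def g_def inflate_def)
  \<comment> \<open>Both instances of \<open>odd_gf_eq\<close>, with the two weights exchanged, form
    the closed system; \<open>sp(1)\<close> concerns \<open>odd_gf f g\<close> and
    \<open>sp(2)\<close> concerns \<open>odd_gf g f\<close>.\<close>
  note sp = sparse_system[OF odd_gf_eq odd_gf_eq this]
  ultimately have B: "B_fps d a a' s t = C_fps d a a' s t * Cstar_fps d a a' s t"
    unfolding C Cs using decimate_mult[OF assms(1) sp(2)] by simp
  have eqC: "C_fps d a a' s t = Abs_fps a' oo (fps_X * (fps_const s * Cstar_fps d a a' s t ^ d))"
    unfolding C Cs using decimate_compose[OF assms(1) sp(1), of a' s] odd_gf_eq[of g f]
    by (simp only: g_def)
  have eqCs: "Cstar_fps d a a' s t = Abs_fps a oo (fps_X * (fps_const t * C_fps d a a' s t ^ d))"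
    unfolding C Cs using decimate_compose[OF assms(1) sp(2), of a t] odd_gf_eq[of f g]
    by (simp only: f_def)
  show ?thesis
    using B eqC eqCs composition_system_unique[OF _ _ eqC eqCs] unfolding mult.assoc by blast
qed

end
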